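(* Let $n\ge3$ be an integer. If $n=3$, then there is synchronization for all $\alpha\in(\gamma_{3,3},\epsilon_{3,3})$. If $n>3$, then the set of $\alpha\in(\gamma_{3,n},\epsilon_{3,n})$ for which there is not synchronization is uncountable, but of Lebesgue measure zero.
   Context: Let $n\ge 3$ be an integer and $t=1+2\cos(\pi/n)$. Put $A=\begin{pmatrix}1&t\\0&1\end{pmatrix}$ and $C=\begin{pmatrix}-1&1\\-1&0\end{pmatrix}$, where a matrix $\begin{pmatrix}a&b\\c&d\end{pmatrix}$ acts on real numbers by $x\mapsto\frac{ax+b}{cx+d}$. For $\alpha\in[0,1]$ let $\mathbb I_\alpha=[(\alpha-1)t,\alpha t)$, and let $T_\alpha=T_{3,n,\alpha}$ be the map on the closed interval $[(\alpha-1)t,\alpha t]$, taking values in $\mathbb I_\alpha$, given by $T_\alpha(x)=A^kC^l\cdot x$, where $l\ge1$ is minimal such that $C^l\cdot x\notin\mathbb I_\alpha$ and $k=-\lfloor (C^l\cdot x)/t+1-\alpha\rfloor$. Let $\ell_0(\alpha)=(\alpha-1)t$, $r_0(\alpha)=\alpha t$, and for $i,j\ge1$ let $\ell_i(\alpha)=T_\alpha^i(\ell_0(\alpha))$, $r_j(\alpha)=T_\alpha^j(r_0(\alpha))$. Synchronization occurs at $\alpha$ if there exist $i,j$ such that $r_j(\alpha)=\ell_i(\alpha)$. The number $\gamma_{3,n}\in(0,1)$ is the value of $\alpha$ such that $C^{-1}\cdot\ell_0(\alpha)=r_0(\alpha)$, and $\epsilon_{3,n}\in(0,1)$ is the value of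 $\alpha$ such that $A^{-1}C\cdot\ell_0(\alpha)=r_0(\alpha)$. *)

theory Defs
  imports "HOL-Analysis.Analysis"
begin

definition mat2 :: "real \<Rightarrow> real \<Rightarrow> real \<Rightarrow> real \<Rightarrow> real^2^2" where
  "mat2 a b c d = vector [vector [a, b], vector [c, d]]"

(* The power operation (^) on real^2^2 is componentwise, so powers with respect to the matrix
   product are introduced here. *)
definition mat_pow :: "real^2^2 \<Rightarrow> int \<Rightarrow> real^2^2" where
  "mat_pow M k =
     (if 0 \<le> k then (((**) M) ^^ nat k) (mat 1)
      else (((**) (matrix_inv M)) ^^ nat (- k)) (mat 1))"

(* The Moebius action on real points; the value None is the point at infinity. *)
definition moeb :: "real^2^2 \<Rightarrow> real \<Rightarrow> real option" where
  "moeb M x =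
     (let den = M $ 2 $ 1 * x + M $ 2 $ 2
      in if den = 0 then None else Some ((M $ 1 $ 1 * x + M $ 1 $ 2) / den))"

definition tpar :: "nat \<Rightarrow> real" where
  "tpar n = 1 + 2 * cos (pi / real n)"

definition matA :: "nat \<Rightarrow> real^2^2" where
  "matA n = mat2 1 (tpar n) 0 1"

definition matC :: "real^2^2" where
  "matC = mat2 (- 1) 1 (- 1) 0"

definition ell0 :: "nat \<Rightarrow> real \<Rightarrow> real" where
  "ell0 n \<alpha> = (\<alpha> - 1) * tpar n"

definition r0 :: "nat \<Rightarrow> real \<Rightarrow> real" where
  "r0 n \<alpha> = \<alpha> * tpar n"

definition Ialpha :: "nat \<Rightarrow> real \<Rightarrow> real set" where
  "Ialpha n \<alpha> = {ell0 n \<alpha> ..< r0 n \<alpha>}"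

(* Infinity counts as lying outside the interval. *)
definition lexp :: "nat \<Rightarrow> real \<Rightarrow> real \<Rightarrow> nat" where
  "lexp n \<alpha> x =
     (LEAST l. 1 \<le> l \<and> moeb (mat_pow matC (int l)) x \<notin> Some ` Ialpha n \<alpha>)"

(* Only the values on the closed interval from ell0 to r0 matter.  If C^l x is infinity (for x = 0,
   and for x = 1 when C 1 = 0 lies in the interval), the formula for the exponent of A does not
   apply; as usual for continued fraction maps, the value there is 0, which lies in the interval
   whenever 0 < \<alpha> \<le> 1. *)
definition Tmap :: "nat \<Rightarrow> real \<Rightarrow> real \<Rightarrow> real" where
  "Tmap n \<alpha> x =
     (let M = mat_pow matC (int (lexp n \<alpha> x))
      in case moeb M x of
           None \<Rightarrow> 0
         | Some y \<Rightarrow>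
             (let k = - \<lfloor>y / tpar n + 1 - \<alpha>\<rfloor>
              in the (moeb (mat_pow (matA n) k ** M) x)))"

definition ell_orbit :: "nat \<Rightarrow> real \<Rightarrow> nat \<Rightarrow> real" where
  "ell_orbit n \<alpha> i = (Tmap n \<alpha> ^^ i) (ell0 n \<alpha>)"

definition r_orbit :: "nat \<Rightarrow> real \<Rightarrow> nat \<Rightarrow> real" where
  "r_orbit n \<alpha> j = (Tmap n \<alpha> ^^ j) (r0 n \<alpha>)"

definition synchronizes :: "nat \<Rightarrow> real \<Rightarrow> bool" where
  "synchronizes n \<alpha> \<longleftrightarrow> (\<exists>i\<ge>1. \<exists>j\<ge>1. r_orbit n \<alpha> j = ell_orbit n \<alpha> i)"

definition gamma3 :: "nat \<Rightarrow> real" where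
  "gamma3 n =
     (THE \<alpha>. 0 < \<alpha> \<and> \<alpha> < 1 \<and> moeb (matrix_inv matC) (ell0 n \<alpha>) = Some (r0 n \<alpha>))"

definition epsilon3 :: "nat \<Rightarrow> real" where
  "epsilon3 n =
     (THE \<alpha>. 0 < \<alpha> \<and> \<alpha> < 1 \<and>
        moeb (matrix_inv (matA n) ** matC) (ell0 n \<alpha>) = Some (r0 n \<alpha>))"

end

theory Submission
  imports Defs
begin

text \<open>
  Put \<open>\<lambda> = t - 1 = 2 cos (\<pi> / n)\<close>, and let \<open>W = A\<^sup>-\<^sup>1 C\<close>, that is \<open>W x = -\<lambda> - 1 / x\<close>, an elliptic
  element of order \<open>n\<close>. Let \<open>a\<close> be the left end point of the interval, so that the right one is \<open>r
  = A a\<close>. On negative points the left orbit follows \<open>W\<close>. On points greater than one the right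
  orbit follows \<open>A W\<^sup>-\<^sup>1 A\<^sup>-\<^sup>1\<close>. Up to the translation \<open>A\<close>, the two orbits thus run along one
  finite \<open>W\<close>-orbit in opposite directions, and they tend to meet.

  If \<open>r \<le> 1\<close> and \<open>\<alpha>\<close> exceeds \<open>\<gamma>\<close>, they do meet (\<open>synchronizes_if_r_le_1\<close>). For \<open>r > 1\<close> let \<open>z\<close> be
  the first nonnegative point of the \<open>W\<close>-orbit of \<open>a\<close>. Since \<open>W\<close> has order \<open>n\<close>, the left orbit
  comes to \<open>z\<close> and the right one to \<open>C z\<close>, up to translation, and there is synchronization unless
  \<open>z \<ge> r\<close> and \<open>C\<^sup>2 z < a\<close>. In this exceptional case \<open>S a = z - t\<close> lies in \<open>[a, W a)\<close>, and the two
  orbits are again in essentially the initial configuration, with \<open>S a\<close> in place of \<open>a\<close>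
  (\<open>linked_step\<close>). Hence synchronization fails only if all iterates of \<open>a\<close> under the piecewise
  Moebius map \<open>S\<close> stay in \<open>[a, W a)\<close>. Conversely, if they do, the left orbit stays negative and
  the right one positive (\<open>not_synchronizes_if_sequence\<close>).

  For \<open>n = 3\<close> the map \<open>S\<close> has a single branch, and \<open>S a < a\<close> by the definition of \<open>\<epsilon>\<close>.

  In general \<open>S\<close> has \<open>n - 2\<close> branches, each of them mapping onto \<open>[-t, \<infinity>)\<close>, whereas the orbit has
  to stay in \<open>[-\<lambda>, 0)\<close>. At every step a fixed proportion of the length is lost, with a bound that
  is uniform by the form of Moebius maps (\<open>survivors_image_cover\<close>). So the exceptional set is
  null.

  For \<open>n > 3\<close> there are at least two branches, and \<open>S\<close> resembles an expanding map of a circle, in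
  which \<open>[a, W a)\<close> is an arc that is mapped injectively around the circle, as \<open>S \<circ> W = S\<close>. As for
  the doubling map and its semicircles, orbits inside such an arc are obtained from irrational
  rotations: Sturmian sequences of digits with different irrational slopes yield different points
  \<open>a\<close>, hence uncountably many parameters (\<open>point_less_rot_start\<close>,
  \<open>uncountable_not_synchronizing\<close>).
\<close>

section \<open>The maps as explicit functions\<close>

lemma mat2_nth [simp]:
  "mat2 a b c d $ 1 $ 1 = a" "mat2 a b c d $ 1 $ 2 = b"
  "mat2 a b c d $ 2 $ 1 = c" "mat2 a b c d $ 2 $ 2 = d"
  by (simp_all add: mat2_def)

lemma mat2_mult: "mat2 a b c d ** mat2 e f g h =
    mat2 (a * e + b * g) (a * f + b * h) (c * e + d * g) (c * f + d * h)"
  by (simp add: vec_eq_iff forall_2 matrix_matrix_mult_def sum_2)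

lemma mat_1_mat2: "mat 1 = mat2 1 0 0 1"
  by (simp add: vec_eq_iff forall_2 mat_def)

lemma matrix_inv_mat2_det_1:
  assumes "a * d - b * c = 1"
  shows "matrix_inv (mat2 a b c d) = mat2 d (- b) (- c) a"
proof -
  let ?M = "mat2 a b c d" and ?N = "mat2 d (- b) (- c) a"
  have N: "?M ** ?N = mat 1" "?N ** ?M = mat 1"
    using assms by (simp_all add: mat2_mult mat_1_mat2 algebra_simps)
  have "?M ** matrix_inv ?M = mat 1 \<and> matrix_inv ?M ** ?M = mat 1"
    unfolding matrix_inv_def
    by (rule someI[of "\<lambda>X. ?M ** X = mat 1 \<and> X ** ?M = mat 1" ?N]) (simp only: N simp_thms)
  then have inv: "matrix_inv ?M ** ?M = mat 1" by simp
  have "matrix_inv ?M = matrix_inv ?M ** (?M ** ?N)"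
    by (simp only: N(1) matrix_mul_rid)
  also have "\<dots> = ?N"
    by (simp only: matrix_mul_assoc inv matrix_mul_lid)
  finally show ?thesis .
qed

lemma funpow_shear: "(((**) (mat2 1 u 0 1)) ^^ m) (mat 1) = mat2 1 (real m * u) 0 1"
  by (induction m) (simp_all add: mat_1_mat2 mat2_mult algebra_simps)

lemma mat_pow_matA: "mat_pow (matA n) k = mat2 1 (real_of_int k * tpar n) 0 1"
  by (simp add: mat_pow_def matA_def matrix_inv_mat2_det_1 funpow_shear)

lemma moeb_shear_mult:
  "moeb (mat2 1 u 0 1 ** M) x = map_option (\<lambda>y. y + u) (moeb M x)"
proof -
  have "mat2 1 u 0 1 ** M = mat2 (M$1$1 + u * M$2$1) (M$1$2 + u * M$2$2) (M$2$1) (M$2$2)"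
    by (simp add: vec_eq_iff forall_2 matrix_matrix_mult_def sum_2 mat2_def)
  then show ?thesis
    by (simp add: moeb_def Let_def field_simps)
qed

lemma mat_pow_matC: "mat_pow matC 1 = mat2 (- 1) 1 (- 1) 0"
  "mat_pow matC 2 = mat2 0 (- 1) 1 (- 1)"
  by (simp_all add: mat_pow_def matC_def numeral_2_eq_2 mat2_mult mat_1_mat2)

lemma moeb_C: "moeb (mat_pow matC 1) x = (if x = 0 then None else Some (1 - 1 / x))"
  unfolding mat_pow_matC by (simp add: moeb_def field_simps)

lemma moeb_C2: "moeb (mat_pow matC 2) x = (if x = 1 then None else Some (1 / (1 - x)))"
  unfolding mat_pow_matC by (simp add: moeb_def Let_def divide_simps)

text \<open>
  The representative of \<open>y\<close> modulo translations by \<open>t\<close> in the interval of the map: this is the effect of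
  the power of \<open>A\<close> that the map applies last.
\<close>

definition fold_t :: "nat \<Rightarrow> real \<Rightarrow> real \<Rightarrow> real" where
  "fold_t n \<alpha> y = y - real_of_int \<lfloor>y / tpar n + 1 - \<alpha>\<rfloor> * tpar n"

lemma Tmap_lexp:
  assumes "lexp n \<alpha> x = l"
  shows "Tmap n \<alpha> x = (case moeb (mat_pow matC (int l)) x of None \<Rightarrow> 0 | Some y \<Rightarrow> fold_t n \<alpha> y)"
  by (simp add: Tmap_def assms Let_def mat_pow_matA moeb_shear_mult fold_t_def split: option.split)

lemma lexp_1:
  assumes "moeb (mat_pow matC (int 1)) x \<notin> Some ` Ialpha n \<alpha>"
  shows "lexp n \<alpha> x = 1"
  unfolding lexp_def using assms by (intro Least_equality) auto

lemma lexp_2: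
  assumes "moeb (mat_pow matC (int 1)) x \<in> Some ` Ialpha n \<alpha>"
    and "moeb (mat_pow matC (int 2)) x \<notin> Some ` Ialpha n \<alpha>"
  shows "lexp n \<alpha> x = 2"
  unfolding lexp_def
proof (intro Least_equality conjI)
  fix l assume l: "1 \<le> l \<and> moeb (mat_pow matC (int l)) x \<notin> Some ` Ialpha n \<alpha>"
  then have "l \<noteq> 1" using assms(1) by auto
  with l show "2 \<le> l" by simp
qed (use assms in auto)

text \<open>
  As \<open>C\<close> has order three, only its first two powers are ever used, and the map is
  \<open>x \<mapsto> 1 - 1 / x\<close> or \<open>x \<mapsto> 1 / (1 - x)\<close>, folded back into the interval.
\<close>

lemma Tmap_eq_C:
  assumes "x \<noteq> 0" "1 - 1 / x \<notin> Ialpha n \<alpha>"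
  shows "Tmap n \<alpha> x = fold_t n \<alpha> (1 - 1 / x)"
  using assms by (subst Tmap_lexp[OF lexp_1]) (auto simp: moeb_C)

lemma Tmap_eq_C2:
  assumes "x \<noteq> 0" "x \<noteq> 1" "1 - 1 / x \<in> Ialpha n \<alpha>" "1 / (1 - x) \<notin> Ialpha n \<alpha>"
  shows "Tmap n \<alpha> x = fold_t n \<alpha> (1 / (1 - x))"
  using assms by (subst Tmap_lexp[OF lexp_2]) (auto simp: moeb_C moeb_C2)

lemma Tmap_0: "Tmap n \<alpha> 0 = 0"
  by (subst Tmap_lexp[OF lexp_1]) (auto simp: moeb_C)

lemma Tmap_1: "0 \<in> Ialpha n \<alpha> \<Longrightarrow> Tmap n \<alpha> 1 = 0"
  by (subst Tmap_lexp[OF lexp_2]) (auto simp: moeb_C moeb_C2)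

section \<open>The elliptic element of order \<open>n\<close>\<close>

text \<open>
  With \<open>\<lambda> = t - 1 = 2 cos (\<pi> / n)\<close>, the map \<open>rot\<close> is the action of \<open>A\<^sup>-\<^sup>1 C\<close>, an elliptic
  element of order \<open>n\<close>, and \<open>unrot\<close> is its inverse.  Iterates of \<open>unrot\<close> are used rather than those of \<open>rot\<close>: started at a
  point of \<open>[0, \<infinity>)\<close>, the first \<open>n - 2\<close> of them stay in \<open>[-\<lambda>, 0)\<close> and never meet the pole.
\<close>

definition rot :: "real \<Rightarrow> real \<Rightarrow> real" where
  "rot lam x = - lam - 1 / x"

definition unrot :: "real \<Rightarrow> real \<Rightarrow> real" where
  "unrot lam x = - 1 / (x + lam)"

lemma rot_unrot: "x + lam \<noteq> 0 \<Longrightarrow> rot lam (unrot lam x) = x"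
  by (simp add: rot_def unrot_def)

lemma unrot_rot: "x \<noteq> 0 \<Longrightarrow> unrot lam (rot lam x) = x"
  by (simp add: rot_def unrot_def)

lemma unrot_neg: "x + lam > 0 \<Longrightarrow> unrot lam x < 0"
  by (simp add: unrot_def divide_neg_pos)

lemma unrot_strict_mono: "x + lam > 0 \<Longrightarrow> x < y \<Longrightarrow> unrot lam x < unrot lam y"
  by (simp add: unrot_def frac_less2)

lemma unrot_mono: "x + lam > 0 \<Longrightarrow> x \<le> y \<Longrightarrow> unrot lam x \<le> unrot lam y"
  by (simp add: unrot_def frac_le)

lemma rot_mono: "x \<le> y \<Longrightarrow> y < 0 \<Longrightarrow> rot lam x \<le> rot lam y"
  by (simp add: rot_def divide_inverse le_imp_inverse_le_neg)

locale hecke_param =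
  fixes n :: nat and lam :: real
  assumes n_ge_3: "n \<ge> 3" and lam_eq: "lam = 2 * cos (pi / real n)"
begin

lemma tpar_eq: "tpar n = lam + 1"
  by (simp add: tpar_def lam_eq)

lemma lam_ge_1: "1 \<le> lam" and lam_less_2: "lam < 2"
proof -
  have "pi / real n \<le> pi / 3"
    using n_ge_3 by (intro divide_left_mono) auto
  then have "cos (pi / 3) \<le> cos (pi / real n)"
    by (intro cos_monotone_0_pi_le) auto
  then show "1 \<le> lam" by (simp add: lam_eq cos_60)
  have "pi / real n < pi / 1"
    using n_ge_3 by (intro divide_strict_left_mono) auto
  then have "cos (pi / real n) < cos 0"
    using n_ge_3 by (intro cos_monotone_0_pi) auto
  then show "lam < 2" by (simp add: lam_eq)
qed

text \<open>
  Up to signs and a common factor these are the entries of the powers of the elliptic matrix, by the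
  Chebyshev recursion.
\<close>

definition s :: "nat \<Rightarrow> real" where
  "s k = sin (real k * pi / real n)"

lemma s_rec: "s (k + 2) = lam * s (k + 1) - s k"
proof -
  let ?h = "pi / real n"
  have "sin (real (k + 1) * ?h + ?h) + sin (real (k + 1) * ?h - ?h) = 2 * cos ?h * sin (real (k + 1) * ?h)"
    unfolding sin_add sin_diff by simp
  moreover have "real (k + 1) * ?h + ?h = real (k + 2) * pi / real n"
    "real (k + 1) * ?h - ?h = real k * pi / real n"
    by (simp_all add: field_simps add_divide_distrib)
  ultimately show ?thesis by (simp add: s_def lam_eq)
qed

lemma s_pos: assumes "0 < k" "k < n" shows "0 < s k"
  unfolding s_def
proof (rule sin_gt_zero)
  show "0 < real k * pi / real n" using assms by simp
  have "real k * pi < real n * pi" using assms by simp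
  then show "real k * pi / real n < pi" using assms by (simp add: divide_less_eq mult.commute)
qed

lemma s_0: "s 0 = 0" and s_n: "s n = 0"
  using n_ge_3 by (simp_all add: s_def)

lemma s_nonneg: "k < n \<Longrightarrow> 0 \<le> s k"
  using s_pos[of k] s_0 by (cases "k = 0") auto

text \<open>
  The closed form of the iterates, shifted by \<open>\<lambda>\<close> so that all terms of numerator and denominator are
  nonnegative.  Positivity of \<open>s\<close> up to the index \<open>n - 1\<close>, and its vanishing at \<open>n\<close>, is what
  limits the number of steps to \<open>n - 2\<close>.
\<close>

lemma unrot_pow_add_lam:
  assumes "0 \<le> z" "k \<le> n - 2"
  shows "(unrot lam ^^ k) z + lam = (s (k + 1) * z + s (k + 2)) / (s k * z + s (k + 1))"
  using assms(2)
proof (induction k)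
  case 0
  have "s 1 > 0" using n_ge_3 by (intro s_pos) auto
  then show ?case using s_rec[of 0] by (simp add: s_0 field_simps)
next
  case (Suc k)
  have pos: "s (k + 1) * z + s (k + 2) > 0"
    using Suc.prems n_ge_3 assms(1)
    by (intro add_nonneg_pos mult_nonneg_nonneg s_pos s_nonneg) auto
  have "(unrot lam ^^ Suc k) z + lam = lam - 1 / ((unrot lam ^^ k) z + lam)"
    by (simp add: unrot_def[of lam "(unrot lam ^^ k) z"])
  also have "\<dots> = lam - (s k * z + s (k + 1)) / (s (k + 1) * z + s (k + 2))"
    using Suc by simp
  also have "\<dots> = ((lam * s (k + 1) - s k) * z + (lam * s (k + 2) - s (k + 1)))
      / (s (k + 1) * z + s (k + 2))"
    using pos by (simp add: field_simps)
  also have "\<dots> = (s (Suc k + 1) * z + s (Suc k + 2)) / (s (Suc k) * z + s (Suc k + 1))"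
    using s_rec[of k] s_rec[of "k + 1"] by simp
  finally show ?case .
qed

lemma unrot_pow_add_lam_pos:
  assumes "0 \<le> z" "k < n - 2"
  shows "(unrot lam ^^ k) z + lam > 0"
proof -
  have "s (k + 1) * z + s (k + 2) > 0" "s k * z + s (k + 1) > 0"
    using assms n_ge_3
    by (auto intro!: add_nonneg_pos mult_nonneg_nonneg s_pos s_nonneg)
  then show ?thesis using assms by (simp add: unrot_pow_add_lam)
qed

lemma unrot_pow_last:
  assumes "0 \<le> z"
  shows "(unrot lam ^^ (n - 2)) z = z / (lam * z + 1) - lam"
proof -
  have "s (n - 2 + 2) = lam * s (n - 2 + 1) - s (n - 2)" by (rule s_rec)
  then have "s (n - 2) = lam * s (n - 1)" "s (n - 2 + 1) = s (n - 1)" "s (n - 2 + 2) = 0"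
    using n_ge_3 s_n by (simp_all add: numeral_2_eq_2 Suc_diff_Suc)
  moreover have "s (n - 1) > 0" using n_ge_3 by (intro s_pos) auto
  ultimately have "(unrot lam ^^ (n - 2)) z + lam = z * s (n - 1) / ((lam * z + 1) * s (n - 1))"
    using unrot_pow_add_lam[OF assms, of "n - 2"] by (simp add: algebra_simps)
  with \<open>s (n - 1) > 0\<close> show ?thesis by simp
qed

lemma unrot_pow_ge:
  assumes "0 \<le> z" "k \<le> n - 2"
  shows "- lam \<le> (unrot lam ^^ k) z"
proof (cases "k = n - 2")
  case True
  have "z / (lam * z + 1) \<ge> 0" using assms lam_ge_1 by simp
  with True show ?thesis using unrot_pow_last[OF assms(1)] by simp
next
  case False
  then show ?thesis using unrot_pow_add_lam_pos[OF assms(1), of k] assms by simp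
qed

lemma unrot_pow_gt:
  assumes "0 < z" "k \<le> n - 2"
  shows "- lam < (unrot lam ^^ k) z"
proof (cases "k = n - 2")
  case True
  have "0 < z / (lam * z + 1)"
    using assms lam_ge_1 by (intro divide_pos_pos add_pos_pos mult_pos_pos) auto
  with True show ?thesis using unrot_pow_last[of z] assms by simp
next
  case False
  then show ?thesis using unrot_pow_add_lam_pos[of z k] assms by simp
qed

lemma unrot_pow_strict_mono:
  assumes "0 \<le> z" "z < z'" "k \<le> n - 2"
  shows "(unrot lam ^^ k) z < (unrot lam ^^ k) z'"
  using assms(3)
proof (induction k)
  case (Suc k)
  then show ?case
    using unrot_pow_add_lam_pos[OF assms(1), of k] by (simp add: unrot_strict_mono)
qed (use assms in simp)

lemma unrot_pow_mono:
  "0 \<le> z \<Longrightarrow> z \<le> z' \<Longrightarrow> k \<le> n - 2 \<Longrightarrow> (unrot lam ^^ k) z \<le> (unrot lam ^^ k) z'"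
  using unrot_pow_strict_mono[of z z' k] by (cases "z = z'") auto

lemma unrot_pow_inj:
  "(unrot lam ^^ k) z = (unrot lam ^^ k) z' \<Longrightarrow> 0 \<le> z \<Longrightarrow> 0 \<le> z' \<Longrightarrow> k \<le> n - 2 \<Longrightarrow> z = z'"
  using unrot_pow_strict_mono[of z z' k] unrot_pow_strict_mono[of z' z k] by (cases z z' rule: linorder_cases) auto

lemma unrot_pow_neg:
  assumes "0 \<le> z" "1 \<le> k" "k \<le> n - 2"
  shows "(unrot lam ^^ k) z < 0"
proof -
  obtain j where "k = Suc j" using assms by (cases k) auto
  then show ?thesis
    using unrot_pow_add_lam_pos[OF assms(1), of j] assms by (simp add: unrot_neg)
qed

text \<open>
  The rotation has no real fixed point, since its trace has absolute value \<open>\<lambda> < 2\<close>, so it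
  moves all points to the right of the pole of \<open>unrot\<close> in the same direction.
\<close>

lemma unrot_less:
  assumes "x + lam > 0" shows "unrot lam x < x"
proof -
  have "(x + lam / 2)\<^sup>2 + (1 - lam * lam / 4) > 0"
  proof -
    have "lam * lam < 2 * 2" using lam_ge_1 lam_less_2 by (intro mult_strict_mono) auto
    then show ?thesis by (intro add_nonneg_pos) auto
  qed
  then have "x * (x + lam) + 1 > 0" by (simp add: power2_eq_square field_simps)
  then show ?thesis using assms by (simp add: unrot_def field_simps)
qed

lemma unrot_pow_antimono:
  assumes "0 \<le> z" "i \<le> k" "k \<le> n - 2"
  shows "(unrot lam ^^ k) z \<le> (unrot lam ^^ i) z"
  using assms(2,3)
proof (induction rule: dec_induct)
  case (step k)
  then show ?case
    using unrot_less[OF unrot_pow_add_lam_pos[OF assms(1), of k]] by simp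
qed simp

text \<open>
  One step beyond the last admissible iterate: since \<open>rot\<close> has order \<open>n\<close>, applying \<open>unrot\<close>
  \<open>n - 1\<close> times is the same as applying \<open>rot\<close> once.
\<close>

lemma unrot_unrot_pow_last:
  assumes "0 < z"
  shows "unrot lam ((unrot lam ^^ (n - 2)) z) = - lam - 1 / z"
  using assms lam_ge_1 by (simp add: unrot_pow_last unrot_def field_simps)

lemma unrot_unrot_pow_ge:
  assumes "1 \<le> z" "k \<le> n - 2"
  shows "- lam - 1 \<le> unrot lam ((unrot lam ^^ k) z)"
proof (cases "k = n - 2")
  case True
  then show ?thesis using assms by (simp add: unrot_unrot_pow_last)
next
  case False
  then show ?thesis using assms unrot_pow_ge[of z "Suc k"] by simp
qed

text \<open>
  The points \<open>unrot\<^sup>k(0)\<close> for \<open>k \<le> n - 2\<close> cut \<open>[-\<lambda>, 0)\<close> into the pieces \<open>unrot\<^sup>k [0, \<infinity>)\<close>; going forward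
  by \<open>rot\<close>, a point passes from piece to piece until it enters \<open>[0, \<infinity>)\<close>.
\<close>

lemma unrot_pow_covers:
  assumes "- lam \<le> x" "x < 0"
  shows "\<exists>k z. 1 \<le> k \<and> k \<le> n - 2 \<and> 0 \<le> z \<and> x = (unrot lam ^^ k) z"
proof -
  have "\<exists>i z. 1 \<le> i \<and> i \<le> k \<and> 0 \<le> z \<and> x = (unrot lam ^^ i) z"
    if "k \<le> n - 2" "(unrot lam ^^ k) 0 \<le> x" "x < 0" for k x
    using that
  proof (induction k arbitrary: x)
    case 0
    then show ?case by simp
  next
    case (Suc k)
    have x: "x = unrot lam (rot lam x)" using Suc.prems by (simp add: unrot_rot)
    show ?case
    proof (cases "rot lam x \<ge> 0")
      case True
      with x show ?thesis
        by (intro exI[of _ 1] exI[of _ "rot lam x"]) auto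
    next
      case False
      have "rot lam (unrot lam ((unrot lam ^^ k) 0)) \<le> rot lam x"
        using Suc.prems by (intro rot_mono) auto
      then have "(unrot lam ^^ k) 0 \<le> rot lam x"
        using unrot_pow_add_lam_pos[of 0 k] Suc.prems by (simp add: rot_unrot)
      with Suc.IH[of "rot lam x"] False Suc.prems obtain i z
        where "1 \<le> i" "i \<le> k" "0 \<le> z" "rot lam x = (unrot lam ^^ i) z" by auto
      with x show ?thesis
        by (intro exI[of _ "Suc i"] exI[of _ z]) auto
    qed
  qed
  from this[of "n - 2" x] show ?thesis using assms unrot_pow_last[of 0] by auto
qed

end

section \<open>Following the two end point orbits\<close>

text \<open>
  Here \<open>a\<close> is the left end point of the interval, and \<open>a + \<lambda> + 1\<close> the right one; the condition
  that the right end point exceeds one reads \<open>-\<lambda> < a\<close>.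
\<close>

locale alpha_param = hecke_param +
  fixes \<alpha> a :: real
  assumes a_eq: "a = ell0 n \<alpha>" and alpha_pos: "0 < \<alpha>" and alpha_less_1: "\<alpha> < 1"
begin

lemma r0_eq: "r0 n \<alpha> = a + lam + 1"
  by (simp add: a_eq r0_def ell0_def tpar_eq algebra_simps)

lemma Ialpha_eq: "Ialpha n \<alpha> = {a ..< a + lam + 1}"
  by (simp add: Ialpha_def r0_eq a_eq)

lemma a_neg: "a < 0" and r_pos: "a + lam + 1 > 0"
proof -
  show "a < 0"
    using alpha_less_1 lam_ge_1 by (simp add: a_eq ell0_def tpar_eq mult_neg_pos)
  have "a + lam + 1 = \<alpha> * (lam + 1)"
    by (simp add: a_eq ell0_def tpar_eq algebra_simps)
  then show "a + lam + 1 > 0"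
    using alpha_pos lam_ge_1 by simp
qed

lemma zero_in: "0 \<in> Ialpha n \<alpha>"
  using a_neg r_pos by (simp add: Ialpha_eq)

lemma floor_eq: "y / tpar n + 1 - \<alpha> = (y - a) / (lam + 1)"
  using lam_ge_1 by (simp add: a_eq ell0_def tpar_eq field_simps)

lemma fold_eq:
  assumes "y - of_int k * (lam + 1) \<in> Ialpha n \<alpha>"
  shows "fold_t n \<alpha> y = y - of_int k * (lam + 1)"
proof -
  have "\<lfloor>(y - a) / (lam + 1)\<rfloor> = k"
    using assms lam_ge_1 by (intro floor_unique) (auto simp: Ialpha_eq field_simps)
  then show ?thesis by (simp add: fold_t_def floor_eq) (simp add: tpar_eq)
qed

lemma fold_id: "y \<in> Ialpha n \<alpha> \<Longrightarrow> fold_t n \<alpha> y = y"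
  using fold_eq[of y 0] by simp

lemma fold_shift: "fold_t n \<alpha> (y + (lam + 1)) = fold_t n \<alpha> y"
proof -
  have "(y + (lam + 1) - a) / (lam + 1) = (y - a) / (lam + 1) + 1"
    using lam_ge_1 by (simp add: field_simps)
  then show ?thesis
    by (simp add: fold_t_def floor_eq) (simp add: tpar_eq algebra_simps)
qed

text \<open>
  On the points used below that are negative, the map undoes \<open>unrot\<close>, hence acts by \<open>rot\<close>.
\<close>

lemma Tmap_unrot:
  assumes "0 < y + lam" "a \<le> y"
  shows "Tmap n \<alpha> (unrot lam y) = fold_t n \<alpha> y"
proof -
  have C: "1 - 1 / unrot lam y = y + (lam + 1)"
    using assms by (simp add: unrot_def)
  have "y + (lam + 1) \<notin> Ialpha n \<alpha>"
    using assms by (simp add: Ialpha_eq)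
  then have "1 - 1 / unrot lam y \<notin> Ialpha n \<alpha>"
    by (simp only: C simp_thms)
  then have "Tmap n \<alpha> (unrot lam y) = fold_t n \<alpha> (1 - 1 / unrot lam y)"
    using unrot_neg[OF assms(1)] by (intro Tmap_eq_C) auto
  then show ?thesis
    by (simp only: C fold_shift)
qed

text \<open>
  Synchronization asks for a common point of the two orbits with positive indices.  Disregarding
  the indices is harmless, because points with equal images under the map synchronize one
  step later.
\<close>

definition hits_l :: "real \<Rightarrow> bool" where
  "hits_l x \<longleftrightarrow> (\<exists>i. ell_orbit n \<alpha> i = x)"

definition hits_r :: "real \<Rightarrow> bool" where
  "hits_r x \<longleftrightarrow> (\<exists>j. r_orbit n \<alpha> j = x)"

lemma hits_l_start: "hits_l a"
  unfolding hits_l_def by (rule exI[of _ 0]) (simp add: ell_orbit_def a_eq)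

lemma hits_r_start: "hits_r (a + lam + 1)"
  unfolding hits_r_def by (rule exI[of _ 0]) (simp add: r_orbit_def r0_eq)

lemma hits_l_Tmap: "hits_l x \<Longrightarrow> hits_l (Tmap n \<alpha> x)"
  unfolding hits_l_def ell_orbit_def by (metis funpow.simps(2) o_apply)

lemma hits_r_Tmap: "hits_r x \<Longrightarrow> hits_r (Tmap n \<alpha> x)"
  unfolding hits_r_def r_orbit_def by (metis funpow.simps(2) o_apply)

lemma synchronizes_if_Tmap_eq:
  assumes "hits_l x" "hits_r y" "Tmap n \<alpha> x = Tmap n \<alpha> y"
  shows "synchronizes n \<alpha>"
proof -
  obtain i j where "ell_orbit n \<alpha> i = x" "r_orbit n \<alpha> j = y"
    using assms by (auto simp: hits_l_def hits_r_def)
  then have "r_orbit n \<alpha> (Suc j) = ell_orbit n \<alpha> (Suc i)"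
    using assms(3) by (simp add: ell_orbit_def r_orbit_def)
  then show ?thesis
    unfolding synchronizes_def by (intro exI[of _ "Suc i"] conjI exI[of _ "Suc j"]) auto
qed

lemma synchronizes_if_hits: "hits_l x \<Longrightarrow> hits_r x \<Longrightarrow> synchronizes n \<alpha>"
  by (rule synchronizes_if_Tmap_eq) auto

text \<open>
  The left orbit runs up the chain \<open>unrot\<^sup>k z, \<dots>, unrot z\<close> and then to the representative of \<open>z\<close>.
\<close>

lemma hits_l_fold:
  assumes "0 \<le> z" "k \<le> n - 2" "hits_l ((unrot lam ^^ k) z)" "(unrot lam ^^ k) z \<in> Ialpha n \<alpha>"
  shows "hits_l (fold_t n \<alpha> z)"
  using assms(2-4)
proof (induction k)
  case 0
  then show ?case by (simp add: fold_id)
next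
  case (Suc k)
  define y where "y = (unrot lam ^^ k) z"
  have y: "0 < y + lam"
    using unrot_pow_add_lam_pos[OF assms(1), of k] Suc.prems by (simp add: y_def)
  have "(unrot lam ^^ Suc k) z \<le> y"
    using unrot_less[OF y] by (simp add: y_def)
  then have "a \<le> y"
    using Suc.prems by (simp add: Ialpha_eq)
  then have fold: "hits_l (fold_t n \<alpha> y)"
    using hits_l_Tmap[OF Suc.prems(2)] Tmap_unrot[OF y] by (simp add: y_def)
  show ?case
  proof (cases "k = 0")
    case True
    with fold show ?thesis by (simp add: y_def)
  next
    case False
    then have "y < 0"
      using unrot_pow_neg[OF assms(1), of k] Suc.prems by (simp add: y_def)
    then have "y \<in> Ialpha n \<alpha>"
      using \<open>a \<le> y\<close> r_pos by (simp add: Ialpha_eq)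
    with fold Suc show ?thesis by (simp add: y_def fold_id)
  qed
qed

text \<open>
  Beyond one, the map always uses \<open>C\<^sup>2\<close>: otherwise \<open>y\<close> and \<open>C\<^sup>2 y = - 1 / (y - 1)\<close> would both lie
  in an interval of length \<open>\<lambda> + 1 < 3\<close>, while \<open>y - 1 + 1 / (y - 1) \<ge> 2\<close>.
\<close>

lemma Tmap_gt_1:
  assumes "1 < y" "y \<le> a + lam + 1"
  shows "Tmap n \<alpha> y = fold_t n \<alpha> (1 / (1 - y))" and "1 / (1 - y) < a"
proof -
  have "y - 1 + 1 / (y - 1) > lam"
  proof -
    have "(y - 1 - 1)\<^sup>2 \<ge> 0" by simp
    then have "(y - 1) * (y - 1) + 1 \<ge> 2 * (y - 1)" by (simp add: power2_eq_square algebra_simps)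
    then have "y - 1 + 1 / (y - 1) \<ge> 2" using assms by (simp add: field_simps)
    then show ?thesis using lam_less_2 by simp
  qed
  moreover have "1 / (1 - y) = - (1 / (y - 1))"
    using assms by (simp add: field_simps)
  ultimately show C2: "1 / (1 - y) < a"
    using assms(2) by linarith
  have "0 < 1 / y" "1 / y < 1" using assms(1) by simp_all
  then have C: "1 - 1 / y \<in> Ialpha n \<alpha>"
    using a_neg assms unfolding Ialpha_eq atLeastLessThan_iff by linarith
  show "Tmap n \<alpha> y = fold_t n \<alpha> (1 / (1 - y))"
    using C C2 assms by (intro Tmap_eq_C2) (auto simp: Ialpha_eq)
qed

text \<open>
  After translation by \<open>t\<close>, the map acts by \<open>unrot\<close>: the right orbit moves against the direction of
  the left one.
\<close>

lemma Tmap_translate: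
  assumes "0 < y + lam" "y \<le> a"
  shows "Tmap n \<alpha> (y + lam + 1) = fold_t n \<alpha> (unrot lam y)"
    and "a \<le> unrot lam y + lam + 1 \<Longrightarrow> Tmap n \<alpha> (y + lam + 1) = unrot lam y + lam + 1"
proof -
  have "1 / (1 - (y + lam + 1)) = unrot lam y"
    using assms by (simp add: unrot_def field_simps)
  then show T: "Tmap n \<alpha> (y + lam + 1) = fold_t n \<alpha> (unrot lam y)"
    using Tmap_gt_1(1)[of "y + lam + 1"] assms by simp
  show "Tmap n \<alpha> (y + lam + 1) = unrot lam y + lam + 1" if "a \<le> unrot lam y + lam + 1"
    using T fold_eq[of "unrot lam y" "- 1"] that unrot_less[OF assms(1)] assms(2)
    by (simp add: Ialpha_eq)
qed

text \<open>
  With \<open>z = x + t\<close>, the relation \<open>C\<^sup>2 z = unrot x\<close> brings the right orbit from \<open>C z\<close> back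
  to a translated \<open>unrot\<close>-point.
\<close>

lemma Tmap_C:
  assumes "1 < x + lam + 1" "unrot lam x < a" "a \<le> unrot lam x + lam + 1"
  shows "Tmap n \<alpha> (1 - 1 / (x + lam + 1)) = unrot lam x + lam + 1"
proof -
  have "1 - 1 / (1 - 1 / (x + lam + 1)) = unrot lam x"
    using assms(1) by (simp add: unrot_def field_simps)
  then have "Tmap n \<alpha> (1 - 1 / (x + lam + 1)) = fold_t n \<alpha> (unrot lam x)"
    using assms(1,2) Tmap_eq_C[of "1 - 1 / (x + lam + 1)" n \<alpha>] by (simp add: Ialpha_eq)
  then show ?thesis
    using fold_eq[of "unrot lam x" "- 1"] assms by (simp add: Ialpha_eq)
qed

text \<open>
  The three points of a \<open>C\<close>-orbit are never all in the interval: they are too far apart.  So if two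
  consecutive ones are, the map sends both to the representative of the third, or to \<open>0\<close> if
  the third is infinite.
\<close>

lemma Tmap_C_eq:
  assumes "0 < z" "z < a + lam + 1" "1 - 1 / z \<in> Ialpha n \<alpha>"
  shows "Tmap n \<alpha> z = Tmap n \<alpha> (1 - 1 / z)"
proof (cases "z = 1")
  case True
  then show ?thesis by (simp add: Tmap_0 Tmap_1 zero_in)
next
  case False
  define w where "w = 1 - 1 / z"
  have w: "w \<noteq> 0" "1 - 1 / w = 1 / (1 - z)"
    using assms(1) False by (simp_all add: w_def field_simps)
  have "1 / (1 - z) \<notin> Ialpha n \<alpha>"
  proof (cases "z < 1")
    case True
    then have "w < 0" using assms(1) by (simp add: w_def)
    have "- w + 1 / (- w) \<ge> 2"
    proof -
      have "(- w - 1)\<^sup>2 \<ge> 0" by simp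
      then have "(- w) * (- w) + 1 \<ge> 2 * (- w)" by (simp add: power2_eq_square algebra_simps)
      then show ?thesis using \<open>w < 0\<close> by (simp add: field_simps)
    qed
    moreover have "a \<le> w" using assms(3) by (simp add: w_def Ialpha_eq)
    moreover have "1 / (- w) = - (1 / w)" by simp
    ultimately have "1 - 1 / w \<ge> a + lam + 1" using lam_less_2 by linarith
    then show ?thesis by (simp add: w(2) Ialpha_eq)
  next
    case False
    with \<open>z \<noteq> 1\<close> Tmap_gt_1(2)[of z] assms(2) show ?thesis by (simp add: Ialpha_eq)
  qed
  then show ?thesis
    using assms False w by (subst Tmap_eq_C2) (auto simp: Tmap_eq_C w_def[symmetric])
qed

text \<open>
  If the right end point \<open>r\<close> is one, both orbits end in the fixed point \<open>0\<close>.  If \<open>r < 1\<close>, then \<open>r\<close>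
  is sent to the representative of \<open>y = C\<^sup>2 r\<close>, while \<open>a\<close> equals \<open>unrot\<^sup>n\<^sup>-\<^sup>1 y\<close>, so that the left orbit
  reaches the same representative.  The second assumption means that \<open>C r\<close> exceeds \<open>a\<close>.
\<close>

lemma synchronizes_if_r_le_1:
  assumes "a \<le> - lam" "a < - lam \<Longrightarrow> (a + lam + 1) * (1 - a) > 1"
  shows "synchronizes n \<alpha>"
proof (cases "a = - lam")
  case True
  have "hits_l (fold_t n \<alpha> 0)"
    using hits_l_start True a_neg r_pos
    by (intro hits_l_fold[of 0 "n - 2"]) (auto simp: unrot_pow_last Ialpha_eq)
  then have "hits_l 0" by (simp add: fold_id zero_in)
  moreover have "hits_r 1" using hits_r_start True by simp
  ultimately show ?thesis
    by (rule synchronizes_if_Tmap_eq) (simp add: Tmap_0 Tmap_1 zero_in)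
next
  case False
  define r where "r = a + lam + 1"
  define y where "y = 1 / (1 - r)"
  define q where "q = (unrot lam ^^ (n - 2)) y"
  have r: "0 < r" "r < 1" using False assms(1) r_pos by (auto simp: r_def)
  have "1 < r * (1 - a)" using assms False by (simp add: r_def)
  then have C: "a < 1 - 1 / r" using r by (simp add: field_simps)
  have "1 < y" using r by (simp add: y_def field_simps)
  have "hits_r (fold_t n \<alpha> y)"
  proof -
    have "1 - 1 / r < 0" using r by simp
    then have "1 - 1 / r < r" using r by linarith
    moreover have "y \<notin> Ialpha n \<alpha>" using r \<open>1 < y\<close> by (simp add: Ialpha_eq r_def)
    ultimately have "Tmap n \<alpha> r = fold_t n \<alpha> y"
      using r C unfolding y_def by (intro Tmap_eq_C2) (auto simp: Ialpha_eq r_def[symmetric])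
    then show ?thesis using hits_r_Tmap[OF hits_r_start] by (simp add: r_def)
  qed
  moreover have "hits_l (fold_t n \<alpha> y)"
  proof -
    have q: "- lam < q" "q < 0"
    proof -
      have "0 < y / (lam * y + 1)"
        using lam_ge_1 \<open>1 < y\<close> by (intro divide_pos_pos add_pos_pos mult_pos_pos) auto
      then show "- lam < q" using unrot_pow_last[of y] \<open>1 < y\<close> by (simp add: q_def)
      show "q < 0" using n_ge_3 \<open>1 < y\<close> unfolding q_def by (intro unrot_pow_neg) auto
    qed
    then have "q \<in> Ialpha n \<alpha>" using assms r_pos by (simp add: Ialpha_eq)
    moreover have "unrot lam q = a"
    proof -
      have "unrot lam q = - lam - 1 / y"
        using unrot_unrot_pow_last[of y] \<open>1 < y\<close> by (simp add: q_def)
      then show ?thesis using r by (simp add: y_def r_def)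
    qed
    moreover have "Tmap n \<alpha> (unrot lam q) = fold_t n \<alpha> q"
      using q assms(1) by (intro Tmap_unrot) auto
    ultimately have "hits_l q"
      using hits_l_Tmap[OF hits_l_start] by (simp add: fold_id)
    then show ?thesis
      using \<open>q \<in> Ialpha n \<alpha>\<close> \<open>1 < y\<close> unfolding q_def
      by (intro hits_l_fold[of y "n - 2"]) auto
  qed
  ultimately show ?thesis by (intro synchronizes_if_hits)
qed

text \<open>
  Since \<open>unrot\<close> decreases the points of the chain, they stay below \<open>a\<close>, so that their translates stay in
  the part of the interval beyond one, where the right orbit follows \<open>unrot\<close>.
\<close>

lemma hits_r_chain:
  assumes "0 \<le> z" "i \<le> k" "k \<le> n - 2" "hits_r ((unrot lam ^^ i) z + lam + 1)"
    "(unrot lam ^^ i) z \<le> a" "- lam < a"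
  shows "hits_r ((unrot lam ^^ k) z + lam + 1)"
  using assms(2,3)
proof (induction rule: dec_induct)
  case base
  then show ?case using assms by simp
next
  case (step k)
  define y where "y = (unrot lam ^^ k) z"
  have y: "0 < y + lam" "y \<le> a"
    using unrot_pow_add_lam_pos[OF assms(1), of k] unrot_pow_antimono[OF assms(1), of i k] step assms
    by (simp_all add: y_def)
  have "- lam \<le> unrot lam y"
    using unrot_pow_ge[OF assms(1), of "Suc k"] step by (simp add: y_def)
  then have "Tmap n \<alpha> (y + lam + 1) = unrot lam y + lam + 1"
    using Tmap_translate(2)[OF y] a_neg by simp
  then show ?case
    using hits_r_Tmap[of "y + lam + 1"] step by (simp add: y_def)
qed

text \<open>
  The configuration that recurs: the left orbit is at \<open>x\<close>, and the right one at the translate of \<open>x\<close>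
  (initially, for \<open>x = a\<close>) or at the translate of \<open>unrot x\<close>.  The last inequality keeps that translate in
  the interval, by monotonicity of \<open>unrot\<close>; in this form it does not depend on \<open>x\<close>.
\<close>

definition linked :: "real \<Rightarrow> bool" where
  "linked x \<longleftrightarrow> hits_l x \<and> x \<in> Ialpha n \<alpha> \<and>
    (x = a \<or> x < rot lam a \<and> hits_r (unrot lam x + lam + 1) \<and> a \<le> unrot lam a + lam + 1)"

text \<open>
  Write \<open>z\<close> for the point at which the forward \<open>rot\<close>-orbit of \<open>x\<close> becomes nonnegative.  The right orbit
  runs through the remaining points \<open>unrot\<^sup>j z\<close>, translated, and after the last of them comes
  to the translate of \<open>-\<lambda> - 1 / z\<close>, which is \<open>C z\<close>.
\<close>

lemma linked_hits_r:
  assumes "- lam < a" "linked x" "x = (unrot lam ^^ k) z" "k \<le> n - 2" "0 \<le> z"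
  shows "z = 0 \<Longrightarrow> hits_r 1" and "0 < z \<Longrightarrow> hits_r (fold_t n \<alpha> (1 - 1 / z))"
proof -
  define q where "q = (unrot lam ^^ (n - 2)) z"
  have q: "q = z / (lam * z + 1) - lam" using assms by (simp add: q_def unrot_pow_last)
  have Vq: "unrot lam q + lam + 1 = 1 - 1 / z" if "z > 0"
    using unrot_unrot_pow_last[OF that] by (simp add: q_def)
  have "a \<le> x" "x < a + lam + 1" using assms by (simp_all add: linked_def Ialpha_eq)
  have cases: "hits_r (q + lam + 1) \<and> q \<le> a \<or>
      hits_r (unrot lam q + lam + 1) \<and> a \<le> unrot lam q + lam + 1 \<and> q = x \<and> unrot lam x < a"
  proof (cases "x = a")
    case True
    then have "q \<le> a"
      using assms unrot_pow_antimono[of z k "n - 2"] by (simp add: q_def)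
    with True show ?thesis
      using hits_r_chain[of z k "n - 2"] hits_r_start assms by (simp add: q_def)
  next
    case False
    then have x: "x < rot lam a" "hits_r (unrot lam x + lam + 1)" "a \<le> unrot lam a + lam + 1"
      using assms by (auto simp: linked_def)
    then have "a \<le> unrot lam x + lam + 1"
      using unrot_mono[of a lam x] \<open>a \<le> x\<close> assms(1) by simp
    have Vx: "unrot lam x < a"
      using unrot_strict_mono[of x lam "rot lam a"] x \<open>a \<le> x\<close> assms a_neg
      by (simp add: unrot_rot)
    show ?thesis
    proof (cases "k = n - 2")
      case True
      with x Vx \<open>a \<le> unrot lam x + lam + 1\<close> assms show ?thesis by (simp add: q_def)
    next
      case False
      then have "q \<le> a"
        using assms Vx unrot_pow_antimono[of z "Suc k" "n - 2"] by (simp add: q_def)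
      with False show ?thesis
        using hits_r_chain[of z "Suc k" "n - 2"] x Vx assms by (simp add: q_def)
    qed
  qed
  show "hits_r 1" if "z = 0"
    using cases q that assms(1) \<open>a \<le> x\<close> by auto
  show "hits_r (fold_t n \<alpha> (1 - 1 / z))" if "0 < z"
    using cases
  proof (elim disjE conjE)
    assume h: "hits_r (q + lam + 1)" "q \<le> a"
    have "lam * z + 1 > 0" using that lam_ge_1 by (intro add_pos_pos mult_pos_pos) auto
    then have "q + lam > 0" using q that by simp
    then have "Tmap n \<alpha> (q + lam + 1) = fold_t n \<alpha> (unrot lam q)"
      using h(2) by (rule Tmap_translate)
    also have "fold_t n \<alpha> (unrot lam q) = fold_t n \<alpha> (1 - 1 / z)"
      by (simp only: Vq[OF that, symmetric] add.assoc fold_shift)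
    finally show ?thesis using hits_r_Tmap[OF h(1)] by simp
  next
    assume h: "hits_r (unrot lam q + lam + 1)" "a \<le> unrot lam q + lam + 1" "q = x" "unrot lam x < a"
    with Vq[OF that] show ?thesis by (simp add: fold_id Ialpha_eq)
  qed
qed

text \<open>
  The heart of the matter.  The left orbit comes to \<open>z\<close>, the right one to \<open>C z\<close>, both up to translation.
  If \<open>z\<close> lies in the interval, they synchronize.  Otherwise \<open>z \<ge> r\<close>, the point \<open>C z\<close> lies in
  \<open>(0, 1)\<close>, and \<open>C\<^sup>3 z = z\<close> yields synchronization as soon as \<open>C\<^sup>2 z\<close> lies in the interval.  What remains
  is \<open>C\<^sup>2 z < a\<close>, which says that \<open>x' = z - t\<close> is less than \<open>rot a\<close>; then the configuration is repeated
  with \<open>x'\<close>.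
\<close>

lemma linked_step:
  assumes a: "- lam < a" "rot lam a < a + lam + 1"
    and "linked x" "\<not> synchronizes n \<alpha>"
    and x: "x = (unrot lam ^^ k) z" "k \<le> n - 2" "0 \<le> z"
  shows "1 \<le> k \<and> linked (z - (lam + 1))"
proof -
  have "a \<le> x" "x < a + lam + 1" and hx: "hits_l x" "x \<in> Ialpha n \<alpha>"
    using assms by (simp_all add: linked_def Ialpha_eq)
  have hits_l: "hits_l (fold_t n \<alpha> z)"
    using hits_l_fold[of z k] x hx by simp
  have hits_r: "z = 0 \<Longrightarrow> hits_r 1" "0 < z \<Longrightarrow> hits_r (fold_t n \<alpha> (1 - 1 / z))"
    using linked_hits_r[OF a(1) assms(3) x] by auto
  \<comment> \<open>Inside the interval, \<open>z\<close> and \<open>C z\<close> have the same image, or \<open>z\<close> is mapped to the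
      representative of \<open>C z\<close>; at the pole \<open>z = 0\<close> both orbits end in \<open>0\<close>.\<close>
  have "z \<ge> a + lam + 1"
  proof (rule ccontr)
    assume "\<not> z \<ge> a + lam + 1"
    then have "z \<in> Ialpha n \<alpha>" using x a_neg by (simp add: Ialpha_eq)
    then have hz: "hits_l z" using hits_l by (simp add: fold_id)
    show False
    proof (cases "z = 0")
      case True
      then show False
        using synchronizes_if_Tmap_eq[OF hz hits_r(1)] assms(4) by (simp add: Tmap_0 Tmap_1 zero_in)
    next
      case False
      then have "0 < z" using x by simp
      show False
      proof (cases "1 - 1 / z \<in> Ialpha n \<alpha>")
        case True
        then show False
          using synchronizes_if_Tmap_eq[OF hz hits_r(2)] Tmap_C_eq[of z] assms(4) \<open>0 < z\<close>
            \<open>z \<in> Ialpha n \<alpha>\<close> by (simp add: fold_id Ialpha_eq)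
      next
        case False
        then have "Tmap n \<alpha> z = fold_t n \<alpha> (1 - 1 / z)"
          using \<open>0 < z\<close> by (intro Tmap_eq_C) auto
        then show False
          using synchronizes_if_hits[OF _ hits_r(2)] hits_l_Tmap[OF hz] \<open>0 < z\<close> assms(4) by simp
      qed
    qed
  qed
  then have "1 < z" using a by simp
  have "1 \<le> k"
    using \<open>z \<ge> a + lam + 1\<close> \<open>x < a + lam + 1\<close> x by (cases k) auto
  have "0 < 1 / z" "1 / z < 1" using \<open>1 < z\<close> by simp_all
  then have "1 - 1 / z \<in> Ialpha n \<alpha>"
    using a_neg a unfolding Ialpha_eq atLeastLessThan_iff by linarith
  then have hz: "hits_r (1 - 1 / z)" using hits_r(2) \<open>1 < z\<close> by (simp add: fold_id)
  define x' where "x' = z - (lam + 1)"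
  have C2: "1 - 1 / (1 - 1 / z) = 1 / (1 - z)" "1 / (1 - (1 - 1 / z)) = z" "1 / (1 - z) = unrot lam x'"
    using \<open>1 < z\<close> by (simp_all add: x'_def unrot_def field_simps)
  have "1 / (1 - z) \<notin> Ialpha n \<alpha>"
  proof
    assume *: "1 / (1 - z) \<in> Ialpha n \<alpha>"
    have "Tmap n \<alpha> (1 - 1 / z) = fold_t n \<alpha> (1 / (1 - (1 - 1 / z)))"
      using * C2 \<open>1 < z\<close> \<open>z \<ge> a + lam + 1\<close>
      by (intro Tmap_eq_C2) (auto simp: Ialpha_eq)
    then have "hits_r (fold_t n \<alpha> z)" using hits_r_Tmap[OF hz] C2 by simp
    with hits_l assms(4) show False using synchronizes_if_hits by blast
  qed
  moreover have "1 / (1 - z) < 0" using \<open>1 < z\<close> by simp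
  ultimately have "unrot lam x' < a" using r_pos C2 by (auto simp: Ialpha_eq)
  have "a \<le> x'" using \<open>z \<ge> a + lam + 1\<close> by (simp add: x'_def)
  have "x' < rot lam a"
  proof (rule ccontr)
    assume "\<not> x' < rot lam a"
    moreover have "rot lam a + lam > 0" using a_neg by (simp add: rot_def)
    ultimately have "unrot lam (rot lam a) \<le> unrot lam x'" by (intro unrot_mono) auto
    with \<open>unrot lam x' < a\<close> a_neg show False by (simp add: unrot_rot)
  qed
  then have "x' \<in> Ialpha n \<alpha>" using \<open>a \<le> x'\<close> a by (simp add: Ialpha_eq)
  moreover have "hits_l x'"
    using hits_l fold_shift[of x'] fold_id[of x'] calculation by (simp add: x'_def)
  moreover have ge_a: "a \<le> unrot lam a + lam + 1"
  proof (cases "x = a")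
    case True
    then show ?thesis
      using unrot_unrot_pow_ge[of z k] x \<open>1 < z\<close> a_neg by simp
  next
    case False
    with assms(3) show ?thesis by (simp add: linked_def)
  qed
  then have ge: "a \<le> unrot lam x' + lam + 1"
    using unrot_mono[of a lam x'] \<open>a \<le> x'\<close> a by simp
  moreover have "hits_r (unrot lam x' + lam + 1)"
  proof -
    have "Tmap n \<alpha> (1 - 1 / z) = unrot lam x' + lam + 1"
      using Tmap_C[of x'] \<open>1 < z\<close> \<open>unrot lam x' < a\<close> ge by (simp add: x'_def)
    then show ?thesis using hits_r_Tmap[OF hz] by simp
  qed
  ultimately show ?thesis
    using \<open>1 \<le> k\<close> \<open>x' < rot lam a\<close> ge_a unfolding linked_def x'_def by auto
qed

end

section \<open>The exceptional set is null\<close>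

text \<open>
  The points of \<open>[-\<lambda>, 0)\<close> at which the step \<open>x \<mapsto> z - t\<close> can be performed \<open>N\<close> times without leaving
  \<open>[-\<lambda>, 0)\<close>, described by the inverse branches \<open>y \<mapsto> unrot\<^sup>k (y + t)\<close> of that step.
\<close>

primrec (in hecke_param) survivors :: "nat \<Rightarrow> real set" where
  "survivors 0 = {- lam ..< 0}"
| "survivors (Suc N) = (\<Union>k\<in>{1..n - 2}. (\<lambda>y. (unrot lam ^^ k) (y + (lam + 1))) ` survivors N)"

lemma (in hecke_param) survivors_subset: "survivors N \<subseteq> {- lam ..< 0}"
proof (induction N)
  case (Suc N)
  have "- lam \<le> (unrot lam ^^ k) (y + (lam + 1)) \<and> (unrot lam ^^ k) (y + (lam + 1)) < 0"
    if "y \<in> survivors N" "1 \<le> k" "k \<le> n - 2" for k y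
    using that Suc by (intro conjI unrot_pow_ge unrot_pow_neg) auto
  then show ?case by auto
qed simp

context alpha_param begin

text \<open>
  Without synchronization, linked configurations follow one another forever.  A linked \<open>x\<close> cannot be
  nonnegative: it would be its own \<open>z\<close>, whereas \<open>z \<ge> r > x\<close>.
\<close>

lemma linked_in_survivors:
  assumes "- lam < a" "rot lam a < a + lam + 1" "\<not> synchronizes n \<alpha>" "linked x"
  shows "x \<in> survivors N"
  using assms(4)
proof (induction N arbitrary: x)
  case (0 x)
  then have "a \<le> x" by (simp add: linked_def Ialpha_eq)
  moreover have "x < 0"
    using linked_step[OF assms(1,2) 0 assms(3), of 0 x] by force
  ultimately show ?case using assms(1) by simp
next
  case (Suc N x)
  have "a \<le> x" using Suc.prems by (simp add: linked_def Ialpha_eq)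
  moreover have "x < 0"
    using linked_step[OF assms(1,2) Suc.prems assms(3), of 0 x] by force
  ultimately obtain k z where k: "1 \<le> k" "k \<le> n - 2" "0 \<le> z" "x = (unrot lam ^^ k) z"
    using unrot_pow_covers[of x] assms(1) by auto
  then have "linked (z - (lam + 1))"
    using linked_step[OF assms(1,2) Suc.prems assms(3)] by blast
  then have "z - (lam + 1) \<in> survivors N" by (rule Suc.IH)
  with k show ?case
    by (auto intro!: bexI[of _ k] image_eqI[of _ _ "z - (lam + 1)"])
qed

lemma start_in_survivors:
  assumes "- lam < a" "rot lam a < a + lam + 1" "\<not> synchronizes n \<alpha>"
  shows "a \<in> survivors N"
  using linked_in_survivors[OF assms, of a] hits_l_start a_neg r_pos lam_ge_1
  by (simp add: linked_def Ialpha_eq)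

end

context hecke_param begin

text \<open>
  Composites of an increasing Moebius map \<open>B - \<kappa> / (x + \<sigma>)\<close> with powers of \<open>unrot\<close> have the same shape,
  and their poles stay to the left of \<open>0\<close>.  The constant \<open>B\<close>, the value at infinity, becomes the value
  of the preceding composite at \<open>0\<close>, because \<open>unrot \<infinity> = 0\<close>.
\<close>

lemma moebius_unrot_pow:
  assumes "0 < \<kappa>" "lam < \<sigma>" "\<And>x. - lam \<le> x \<Longrightarrow> g x = B - \<kappa> / (x + \<sigma>)" "1 \<le> k" "k \<le> n - 2"
  shows "\<exists>\<kappa>' \<sigma>'. 0 < \<kappa>' \<and> 0 < \<sigma>' \<and>
    (\<forall>x\<ge>0. g ((unrot lam ^^ k) x) = g ((unrot lam ^^ (k - 1)) 0) - \<kappa>' / (x + \<sigma>'))"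
proof -
  \<comment> \<open>The claim for \<open>k\<close> steps is made on \<open>[e k, \<infinity>)\<close>, the largest domain on which these \<open>k\<close> steps
      stay in \<open>[-\<lambda>, \<infinity>)\<close>.\<close>
  define e where "e k = (unrot lam ^^ (n - 2 - k)) 0" for k
  have e_le: "e k \<le> 0" for k
    using unrot_pow_antimono[of 0 0 "n - 2 - k"] by (simp add: e_def)
  have "\<exists>B' \<kappa>' \<sigma>'. 0 < \<kappa>' \<and> - e k < \<sigma>' \<and>
      (\<forall>x\<ge>e k. g ((unrot lam ^^ k) x) = B' - \<kappa>' / (x + \<sigma>')) \<and>
      (1 \<le> k \<longrightarrow> B' = g ((unrot lam ^^ (k - 1)) 0))"
    using assms(5)
  proof (induction k)
    case 0
    have "e 0 = - lam" by (simp add: e_def unrot_pow_last)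
    with assms show ?case by auto
  next
    case (Suc k)
    then obtain B' \<kappa>' \<sigma>' where IH: "0 < \<kappa>'" "- e k < \<sigma>'"
      "\<And>x. e k \<le> x \<Longrightarrow> g ((unrot lam ^^ k) x) = B' - \<kappa>' / (x + \<sigma>')" by auto
    have "n - 2 - k = Suc (n - 2 - Suc k)" using Suc.prems by simp
    then have ek: "e k = unrot lam (e (Suc k))" by (simp add: e_def)
    have pos: "0 < e (Suc k) + lam"
      unfolding e_def using Suc.prems by (intro unrot_pow_add_lam_pos) auto
    have "0 < \<sigma>'" using IH(2) e_le[of k] by simp
    have "1 / \<sigma>' < e (Suc k) + lam"
    proof -
      have "1 / (e (Suc k) + lam) < \<sigma>'" using IH(2) ek by (simp add: unrot_def)
      then show ?thesis using pos \<open>0 < \<sigma>'\<close> by (simp add: field_simps)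
    qed
    moreover have "g ((unrot lam ^^ Suc k) x) =
        g ((unrot lam ^^ k) 0) - (\<kappa>' / \<sigma>'\<^sup>2) / (x + (lam - 1 / \<sigma>'))" if "e (Suc k) \<le> x" for x
    proof -
      have x: "1 / \<sigma>' < x + lam" using calculation that by simp
      then have "0 < x + lam" using \<open>0 < \<sigma>'\<close> by (meson divide_pos_pos less_trans zero_less_one)
      have "1 < (x + lam) * \<sigma>'" using x \<open>0 < \<sigma>'\<close> by (simp add: field_simps)
      have "e k \<le> unrot lam x" using unrot_mono[OF pos that] ek by simp
      then have "g ((unrot lam ^^ Suc k) x) = B' - \<kappa>' / (\<sigma>' - 1 / (x + lam))"
        by (simp add: funpow_swap1 IH(3)) (simp add: unrot_def)
      also have "\<kappa>' / (\<sigma>' - 1 / (x + lam)) = \<kappa>' / \<sigma>' + (\<kappa>' / \<sigma>'\<^sup>2) / (x + (lam - 1 / \<sigma>'))"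
      proof -
        have "\<sigma>' - 1 / (x + lam) = (\<sigma>' * (x + lam) - 1) / (x + lam)"
          "x + (lam - 1 / \<sigma>') = (\<sigma>' * (x + lam) - 1) / \<sigma>'"
          using \<open>0 < x + lam\<close> \<open>0 < \<sigma>'\<close> by (simp_all add: field_simps)
        moreover have "\<kappa>' / (D / (x + lam)) = \<kappa>' / \<sigma>' + (\<kappa>' / \<sigma>'\<^sup>2) / (D / \<sigma>')"
          if "D = \<sigma>' * (x + lam) - 1" "D \<noteq> 0" for D
          using that(2) \<open>0 < \<sigma>'\<close> \<open>0 < x + lam\<close>
          by (simp add: field_simps power2_eq_square) (simp add: that(1) algebra_simps)
        ultimately show ?thesis using \<open>1 < (x + lam) * \<sigma>'\<close> by (simp add: mult.commute)
      qed
      finally show ?thesis using IH(3)[of 0] e_le by simp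
    qed
    ultimately show ?case
      using IH(1) \<open>0 < \<sigma>'\<close>
      by (intro exI[of _ "g ((unrot lam ^^ k) 0)"] exI[of _ "\<kappa>' / \<sigma>'\<^sup>2"] exI[of _ "lam - 1 / \<sigma>'"])
        auto
  qed
  then obtain \<kappa>' \<sigma>' where "0 < \<kappa>'" "- e k < \<sigma>'"
    "\<forall>x\<ge>e k. g ((unrot lam ^^ k) x) = g ((unrot lam ^^ (k - 1)) 0) - \<kappa>' / (x + \<sigma>')"
    using assms(4) by auto
  with e_le[of k] show ?thesis
    by (intro exI[of _ \<kappa>'] exI[of _ \<sigma>']) auto
qed

text \<open>
  For an increasing Moebius map whose pole lies to the left of \<open>-t\<close>, the image of \<open>[-\<lambda>, 0]\<close> takes up at
  most the fraction \<open>\<lambda> / t\<close> of the image of \<open>[-t, \<infinity>]\<close>, uniformly in the map.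
\<close>

lemma moebius_gap:
  assumes "0 < \<kappa>" "0 < \<sigma>"
  shows "\<kappa> / (1 + \<sigma>) - \<kappa> / (lam + 1 + \<sigma>) \<le> lam / (lam + 1) * (\<kappa> / \<sigma>)"
proof -
  have "\<kappa> / (1 + \<sigma>) - \<kappa> / (lam + 1 + \<sigma>) = lam * \<kappa> / ((1 + \<sigma>) * (lam + 1 + \<sigma>))"
    using assms lam_ge_1 by (simp add: field_simps)
  also have "\<dots> \<le> lam * \<kappa> / (\<sigma> * (lam + 1))"
    using assms lam_ge_1 by (intro divide_left_mono mult_mono mult_pos_pos) auto
  also have "\<dots> = lam / (lam + 1) * (\<kappa> / \<sigma>)" using assms lam_ge_1 by (simp add: field_simps)
  finally show ?thesis .
qed

text \<open>
  Each of the inverse branches maps \<open>[-t, \<infinity>)\<close> onto one piece of \<open>[-\<lambda>, 0)\<close>, and only the image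
  of \<open>[-\<lambda>, 0)\<close> survives.  The lengths of the images of the pieces add up by telescoping, so a step
  multiplies the total length by at most \<open>\<lambda> / t\<close>.  The induction runs over all maps \<open>g\<close>: the
  composites of \<open>g\<close> with a branch are again of this kind.
\<close>

lemma survivors_image_cover:
  assumes "0 < \<kappa>" "lam + 1 < \<sigma>" "\<And>x. - lam - 1 \<le> x \<Longrightarrow> g x = B - \<kappa> / (x + \<sigma>)"
  shows "\<exists>T. T \<in> lmeasurable \<and> g ` survivors N \<subseteq> T \<and>
    measure lebesgue T \<le> (lam / (lam + 1)) ^ N * (g 0 - g (- lam))"
  using assms
proof (induction N arbitrary: g B \<kappa> \<sigma>)
  case 0
  have mono: "g x \<le> g y" if "- lam \<le> x" "x \<le> y" for x y
    using that 0 by (simp add: frac_le)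
  show ?case
    using mono[of "- lam" 0] lam_ge_1
    by (intro exI[of _ "{g (- lam) .. g 0}"]) (auto intro!: mono)
next
  case (Suc N)
  let ?c = "lam / (lam + 1)"
  let ?V = "\<lambda>k. (unrot lam ^^ k)"
  define h where "h k y = g (?V k (y + (lam + 1)))" for k y
  have "\<exists>T. T \<in> lmeasurable \<and> h k ` survivors N \<subseteq> T \<and>
      measure lebesgue T \<le> ?c ^ Suc N * (g (?V (k - 1) 0) - g (?V k 0))" if k: "k \<in> {1..n - 2}" for k
  proof -
    obtain \<kappa>' \<sigma>' where *: "0 < \<kappa>'" "0 < \<sigma>'"
      "\<And>x. 0 \<le> x \<Longrightarrow> g (?V k x) = g (?V (k - 1) 0) - \<kappa>' / (x + \<sigma>')"
      using moebius_unrot_pow[of \<kappa> \<sigma> g B k] Suc.prems k by auto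
    have h: "h k y = g (?V (k - 1) 0) - \<kappa>' / (y + (lam + 1 + \<sigma>'))" if "- lam - 1 \<le> y" for y
      using *(3)[of "y + (lam + 1)"] that by (simp add: h_def add.assoc)
    have "\<exists>T. T \<in> lmeasurable \<and> h k ` survivors N \<subseteq> T \<and>
        measure lebesgue T \<le> ?c ^ N * (h k 0 - h k (- lam))"
      using * h by (intro Suc.IH) auto
    moreover have "h k 0 - h k (- lam) \<le> ?c * (g (?V (k - 1) 0) - g (?V k 0))"
      using moebius_gap[of \<kappa>' \<sigma>'] h[of 0] h[of "- lam"] *(3)[of 0] lam_ge_1 *(1,2) by simp
    then have "?c ^ N * (h k 0 - h k (- lam)) \<le> ?c ^ N * (?c * (g (?V (k - 1) 0) - g (?V k 0)))"
      using lam_ge_1 by (intro mult_left_mono) auto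
    ultimately show ?thesis
      unfolding power_Suc2 mult.assoc by (meson order_trans)
  qed
  then have "\<exists>T. \<forall>k\<in>{1..n - 2}. T k \<in> lmeasurable \<and> h k ` survivors N \<subseteq> T k \<and>
      measure lebesgue (T k) \<le> ?c ^ Suc N * (g (?V (k - 1) 0) - g (?V k 0))"
    by (intro bchoice ballI)
  then obtain T where T: "\<And>k. k \<in> {1..n - 2} \<Longrightarrow> T k \<in> lmeasurable \<and> h k ` survivors N \<subseteq> T k \<and>
      measure lebesgue (T k) \<le> ?c ^ Suc N * (g (?V (k - 1) 0) - g (?V k 0))"
    by blast
  have telescope: "(\<Sum>k\<in>{1..m}. f (k - 1) - f k) = f 0 - f m" for f :: "nat \<Rightarrow> real" and m
    by (induction m) auto
  have "measure lebesgue (\<Union>k\<in>{1..n - 2}. T k) \<le> (\<Sum>k\<in>{1..n - 2}. measure lebesgue (T k))"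
    using T by (intro measure_UNION_le) (auto simp: fmeasurableD)
  also have "\<dots> \<le> (\<Sum>k\<in>{1..n - 2}. ?c ^ Suc N * (g (?V (k - 1) 0) - g (?V k 0)))"
    using T by (intro sum_mono) auto
  also have "\<dots> = ?c ^ Suc N * (\<Sum>k\<in>{1..n - 2}. g (?V (k - 1) 0) - g (?V k 0))"
    by (rule sum_distrib_left[symmetric])
  also have "\<dots> = ?c ^ Suc N * (g 0 - g (?V (n - 2) 0))"
    by (simp only: telescope[of "\<lambda>k. g (?V k 0)"] funpow_0)
  also have "?V (n - 2) 0 = - lam" by (simp add: unrot_pow_last)
  finally have "measure lebesgue (\<Union>k\<in>{1..n - 2}. T k) \<le> ?c ^ Suc N * (g 0 - g (- lam))" .
  moreover have "g ` survivors (Suc N) \<subseteq> (\<Union>k\<in>{1..n - 2}. T k)"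
    using T by (fastforce simp: h_def)
  moreover have "(\<Union>k\<in>{1..n - 2}. T k) \<in> lmeasurable"
    using T by (intro fmeasurable.finite_UN) auto
  ultimately show ?case by blast
qed

text \<open>
  The estimate is for the image under one Moebius map with its pole to the left of \<open>-t\<close>; its inverse is
  smooth on that image.
\<close>

lemma negligible_survivors: "negligible (\<Inter>N. survivors N)"
proof -
  define S where "S = (\<Inter>N. survivors N)"
  \<comment> \<open>Any value greater than \<open>lam + 1\<close> places the pole to the left of \<open>-t\<close>.\<close>
  define \<sigma> where "\<sigma> = lam + 2"
  define g where "g x = 0 - 1 / (x + \<sigma>)" for x :: real
  have "negligible (g ` S)"
    unfolding negligible_outer_le
  proof (intro allI impI)
    fix e :: real assume "0 < e"
    have "(\<lambda>N. (lam / (lam + 1)) ^ N * (g 0 - g (- lam))) \<longlonglongrightarrow> 0"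
      using lam_ge_1 by (intro tendsto_mult_left_zero LIMSEQ_power_zero) auto
    then have "eventually (\<lambda>N. (lam / (lam + 1)) ^ N * (g 0 - g (- lam)) < e) sequentially"
      using \<open>0 < e\<close> by (rule order_tendstoD)
    then obtain N where N: "(lam / (lam + 1)) ^ N * (g 0 - g (- lam)) < e"
      by (auto simp: eventually_sequentially)
    obtain T where "T \<in> lmeasurable" "g ` survivors N \<subseteq> T"
      "measure lebesgue T \<le> (lam / (lam + 1)) ^ N * (g 0 - g (- lam))"
      using survivors_image_cover[of 1 \<sigma> g 0 N] by (auto simp: \<sigma>_def g_def)
    with N show "\<exists>T. g ` S \<subseteq> T \<and> T \<in> lmeasurable \<and> measure lebesgue T \<le> e"
      by (intro exI[of _ T]) (auto simp: S_def)
  qed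
  moreover have "(\<lambda>y. - 1 / y - \<sigma>) differentiable_on g ` S"
  proof -
    have "S \<subseteq> {- lam ..< 0}" using survivors_subset by (auto simp: S_def)
    then have "y \<noteq> 0" if "y \<in> g ` S" for y
      using that by (auto simp: g_def \<sigma>_def)
    then show ?thesis
      unfolding divide_inverse by (intro derivative_intros) auto
  qed
  ultimately have "negligible ((\<lambda>y. - 1 / y - \<sigma>) ` g ` S)"
    by (rule negligible_differentiable_image_negligible[OF order_refl])
  also have "(\<lambda>y. - 1 / y - \<sigma>) ` g ` S = S"
    by (simp add: image_image g_def)
  finally show ?thesis by (simp add: S_def)
qed

end

section \<open>Sturmian sequences without synchronization\<close>

context alpha_param begin

text \<open>
  If all points reached by the step from \<open>a\<close> lie in \<open>[a, rot a)\<close>, then no event of the preceding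
  analysis ever synchronizes the orbits, and both are known completely.  They are disjoint
  because the left one stays negative, whereas the right one stays positive.
\<close>

lemma not_synchronizes_if_sequence:
  fixes x :: "nat \<Rightarrow> real" and k :: "nat \<Rightarrow> nat"
  assumes a: "- lam < a" "x 0 = a"
    and k: "\<And>m. 1 \<le> k m" "\<And>m. k m \<le> n - 2"
    and x: "\<And>m. x m = (unrot lam ^^ k m) (x (Suc m) + lam + 1)"
    and bounds: "\<And>m. a \<le> x m" "\<And>m. x m < rot lam a"
  shows "\<not> synchronizes n \<alpha>"
proof -
  define z where "z m = x (Suc m) + lam + 1" for m
  have z: "1 < z m" for m using bounds(1)[of "Suc m"] a by (simp add: z_def)
  have xz: "x m = (unrot lam ^^ k m) (z m)" for m unfolding z_def by (rule x)
  have x_neg: "x m < 0" for m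
    unfolding xz using z[of m] k by (intro unrot_pow_neg) auto
  have ell: "\<exists>m j. 1 \<le> j \<and> j \<le> k m \<and> ell_orbit n \<alpha> i = (unrot lam ^^ j) (z m)" for i
  proof (induction i)
    case 0
    show ?case
      using k[of 0] xz[of 0] a by (intro exI[of _ 0] exI[of _ "k 0"]) (simp add: ell_orbit_def a_eq)
  next
    case (Suc i)
    then obtain m j where j: "j < k m" "ell_orbit n \<alpha> i = unrot lam ((unrot lam ^^ j) (z m))"
      by (metis Suc_le_D Suc_le_lessD One_nat_def funpow.simps(2) o_apply)
    define y where "y = (unrot lam ^^ j) (z m)"
    have "a \<le> y"
      using unrot_pow_antimono[of "z m" j "k m"] z[of m] j k[of m] xz[of m] bounds(1)[of m]
      by (simp add: y_def)
    moreover have "0 < y + lam"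
      using unrot_pow_add_lam_pos[of "z m" j] z[of m] j k[of m] by (simp add: y_def)
    ultimately have T: "ell_orbit n \<alpha> (Suc i) = fold_t n \<alpha> y"
      using j Tmap_unrot[of y] by (simp add: ell_orbit_def y_def)
    show ?case
    proof (cases "j = 0")
      case True
      have "x (Suc m) \<in> Ialpha n \<alpha>"
        using bounds(1) x_neg[of "Suc m"] r_pos by (simp add: Ialpha_eq)
      then have "fold_t n \<alpha> y = x (Suc m)"
        using fold_shift[of "x (Suc m)"] True by (simp add: y_def z_def fold_id add.assoc)
      then show ?thesis
        using T xz[of "Suc m"] k by (intro exI[of _ "Suc m"] exI[of _ "k (Suc m)"]) simp
    next
      case False
      then have "y < 0"
        unfolding y_def using z[of m] j k[of m] by (intro unrot_pow_neg) auto
      then have "y \<in> Ialpha n \<alpha>" using \<open>a \<le> y\<close> r_pos by (simp add: Ialpha_eq)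
      with T False j show ?thesis
        by (intro exI[of _ m] exI[of _ j]) (simp add: fold_id y_def)
    qed
  qed
  \<comment> \<open>The right orbit is at some \<open>C (z m)\<close>, or at the translate of a point of the chain from \<open>x m\<close> down
      to the last admissible power of \<open>unrot\<close>.\<close>
  have r: "\<exists>m. r_orbit n \<alpha> i = 1 - 1 / z m \<or>
      (\<exists>j. k m \<le> j \<and> j \<le> n - 2 \<and> (unrot lam ^^ j) (z m) \<le> a \<and>
        r_orbit n \<alpha> i = (unrot lam ^^ j) (z m) + lam + 1)" for i
  proof (induction i)
    case 0
    show ?case
      using k[of 0] xz[of 0] a
      by (intro exI[of _ 0] disjI2 exI[of _ "k 0"]) (simp add: r_orbit_def r0_eq)
  next
    case (Suc i)
    then obtain m where m: "r_orbit n \<alpha> i = 1 - 1 / z m \<or>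
      (\<exists>j. k m \<le> j \<and> j \<le> n - 2 \<and> (unrot lam ^^ j) (z m) \<le> a \<and>
        r_orbit n \<alpha> i = (unrot lam ^^ j) (z m) + lam + 1)" by blast
    have last: "unrot lam ((unrot lam ^^ (n - 2)) (z m)) + lam + 1 = 1 - 1 / z m" for m
      using unrot_unrot_pow_last[of "z m"] z[of m] by simp
    from m show ?case
    proof (elim disjE exE conjE)
      assume r: "r_orbit n \<alpha> i = 1 - 1 / z m"
      let ?x = "x (Suc m)"
      have "unrot lam ?x < unrot lam (rot lam a)"
        using bounds(1)[of "Suc m"] bounds(2)[of "Suc m"] a by (intro unrot_strict_mono) auto
      then have lt: "unrot lam ?x < a" using a_neg by (simp add: unrot_rot)
      have "- lam - 1 \<le> unrot lam ?x"
        unfolding xz using z[of "Suc m"] k by (intro unrot_unrot_pow_ge) auto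
      then have T: "r_orbit n \<alpha> (Suc i) = unrot lam ?x + lam + 1"
        using r Tmap_C[of ?x] z[of m] lt a_neg by (simp add: r_orbit_def z_def)
      show ?thesis
      proof (cases "k (Suc m) = n - 2")
        case True
        with T last[of "Suc m"] xz[of "Suc m"] show ?thesis by auto
      next
        case False
        with k[of "Suc m"] T lt xz[of "Suc m"] show ?thesis
          by (intro exI[of _ "Suc m"] disjI2 exI[of _ "Suc (k (Suc m))"]) simp
      qed
    next
      fix j
      assume j: "k m \<le> j" "j \<le> n - 2" "(unrot lam ^^ j) (z m) \<le> a"
        and r: "r_orbit n \<alpha> i = (unrot lam ^^ j) (z m) + lam + 1"
      define y where "y = (unrot lam ^^ j) (z m)"
      have "0 < y + lam"
        using unrot_pow_gt[of "z m" j] z[of m] j by (simp add: y_def)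
      moreover have "- lam - 1 \<le> unrot lam y"
        unfolding y_def using z[of m] j by (intro unrot_unrot_pow_ge) auto
      ultimately have T: "r_orbit n \<alpha> (Suc i) = unrot lam y + lam + 1"
        using r Tmap_translate(2)[of y] j a_neg by (simp add: r_orbit_def y_def)
      show ?thesis
      proof (cases "j = n - 2")
        case True
        with T last[of m] show ?thesis by (auto simp: y_def)
      next
        case False
        have "unrot lam y < a" using unrot_less[of y] \<open>0 < y + lam\<close> j by (simp add: y_def)
        with False j T show ?thesis
          by (intro exI[of _ m] disjI2 exI[of _ "Suc j"]) (simp add: y_def)
      qed
    qed
  qed
  have "ell_orbit n \<alpha> i < 0" for i
  proof -
    obtain m j where "1 \<le> j" "j \<le> k m" "ell_orbit n \<alpha> i = (unrot lam ^^ j) (z m)"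
      using ell by blast
    then show ?thesis using unrot_pow_neg[of "z m" j] z[of m] k[of m] by simp
  qed
  moreover have "0 < r_orbit n \<alpha> i" for i
  proof -
    obtain m where m: "r_orbit n \<alpha> i = 1 - 1 / z m \<or>
      (\<exists>j\<le>n - 2. r_orbit n \<alpha> i = (unrot lam ^^ j) (z m) + lam + 1)" using r by blast
    then show ?thesis
      using z[of m] unrot_pow_ge[of "z m"] by force
  qed
  ultimately show ?thesis
    unfolding synchronizes_def by (metis less_asym)
qed

end

text \<open>
  A Sturmian coding of the step.  The two branches closest to \<open>0\<close>, those with \<open>k = 2\<close> and \<open>k = 1\<close>, are
  used as digits; the first lies to the left of the second.  The digits of \<open>u\<close> are those of
  the rotation by \<open>\<theta>\<close> of the circle, with \<open>k = 1\<close> exactly when an integer is passed.  As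
  \<open>[0, 1 - \<theta>)\<close> is moved to \<open>[\<theta>, 1)\<close> and \<open>[1 - \<theta>, 1)\<close> to \<open>[0, \<theta>)\<close>, the coding preserves the order
  of \<open>[0, 1)\<close>, and the orbit of \<open>0\<close> stays in the required interval.
\<close>

locale sturmian = hecke_param +
  fixes \<theta> :: real
  assumes n_gt_3: "n > 3" and theta: "0 < \<theta>" "\<theta> < 1"
begin

definition digit :: "real \<Rightarrow> nat" where
  "digit u = (if \<lfloor>u + \<theta>\<rfloor> = \<lfloor>u\<rfloor> then 2 else 1)"

text \<open>
  Finite truncations, starting from the lowest point \<open>-\<lambda>\<close>: they increase with \<open>N\<close>, so
  the coded point exists as a supremum.
\<close>

primrec approx :: "nat \<Rightarrow> real \<Rightarrow> real" where
  "approx 0 u = - lam"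
| "approx (Suc N) u = (unrot lam ^^ digit u) (approx N (u + \<theta>) + lam + 1)"

definition point :: "real \<Rightarrow> real" where
  "point u = (SUP N. approx N u)"

lemma digit_cases: "digit u = 1 \<and> \<lfloor>u + \<theta>\<rfloor> = \<lfloor>u\<rfloor> + 1 \<or> digit u = 2 \<and> \<lfloor>u + \<theta>\<rfloor> = \<lfloor>u\<rfloor>"
  using theta by (simp add: digit_def) linarith

lemma digit_bounds: "1 \<le> digit u" "digit u \<le> n - 2"
  using n_gt_3 by (auto simp: digit_def)

lemma approx_bounds: "- lam \<le> approx N u" "approx N u < 0"
proof (induction N arbitrary: u)
  case 0
  { case 1 show ?case by simp }
  { case 2 show ?case using lam_ge_1 by simp }
next
  case (Suc N)
  { case 1 show ?case using Suc(1)[of "u + \<theta>"] digit_bounds by (auto intro!: unrot_pow_ge) }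
  { case 2 show ?case using Suc(1)[of "u + \<theta>"] digit_bounds by (auto intro!: unrot_pow_neg) }
qed

lemma approx_Suc: "approx N u \<le> approx (Suc N) u"
proof (induction N arbitrary: u)
  case 0
  show ?case using approx_bounds(1)[of "Suc 0"] by simp
next
  case (Suc N)
  show ?case
    using Suc[of "u + \<theta>"] approx_bounds(1)[of N "u + \<theta>"] digit_bounds[of u]
    by (simp only: approx.simps(2)[of "Suc N"] approx.simps(2)[of N u] unrot_pow_mono)
qed

lemma approx_periodic: "approx N (u + of_int j) = approx N u"
proof (induction N arbitrary: u)
  case (Suc N)
  have "digit (u + of_int j) = digit u"
    by (simp add: digit_def add.commute[of u] add.assoc)
  moreover have "approx N (u + of_int j + \<theta>) = approx N (u + \<theta>)"
    using Suc[of "u + \<theta>"] by (simp add: algebra_simps)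
  ultimately show ?case by simp
qed simp

lemma unrot_translate_gt:
  assumes "- lam \<le> x" shows "- lam < unrot lam (x + lam + 1)"
proof -
  have "- lam < (unrot lam ^^ 1) (x + lam + 1)"
    using assms n_gt_3 by (intro unrot_pow_gt) auto
  then show ?thesis by simp
qed

text \<open>
  The value \<open>unrot 0\<close> separates the two branches.
\<close>

lemma digit_2_less_digit_1:
  assumes "- lam \<le> x" "- lam \<le> y" "x \<le> 0"
  shows "(unrot lam ^^ 2) (x + lam + 1) < unrot lam (y + lam + 1)"
proof -
  have "- lam < unrot lam (x + lam + 1)"
    using assms by (intro unrot_translate_gt)
  moreover have "unrot lam (x + lam + 1) < 0" using assms lam_ge_1 by (intro unrot_neg) auto
  ultimately have "unrot lam (unrot lam (x + lam + 1)) < unrot lam 0"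
    by (intro unrot_strict_mono) auto
  also have "unrot lam 0 \<le> unrot lam (y + lam + 1)"
    using assms lam_ge_1 by (intro unrot_mono) auto
  finally show ?thesis by (simp add: numeral_2_eq_2)
qed

text \<open>
  For equal digits, both points pass the same integers, and the induction hypothesis applies to
  their translates by \<open>\<theta>\<close>.  If the digits differ, the larger of the two points passes an
  integer, which means the upper branch.
\<close>

lemma approx_mono: "u \<le> v \<Longrightarrow> \<lfloor>u\<rfloor> = \<lfloor>v\<rfloor> \<Longrightarrow> approx N u \<le> approx N v"
proof (induction N arbitrary: u v)
  case (Suc N)
  have le: "\<lfloor>u + \<theta>\<rfloor> \<le> \<lfloor>v + \<theta>\<rfloor>" using Suc.prems by (intro floor_mono) auto
  show ?case
  proof (cases "digit u = digit v")
    case True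
    then have "\<lfloor>u + \<theta>\<rfloor> = \<lfloor>v + \<theta>\<rfloor>"
      using digit_cases[of u] digit_cases[of v] Suc.prems by auto
    then have "approx N (u + \<theta>) \<le> approx N (v + \<theta>)" using Suc by simp
    with True show ?thesis
      using approx_bounds(1)[of N "u + \<theta>"] digit_bounds[of v] by (auto intro!: unrot_pow_mono)
  next
    case False
    then have "digit u = 2" "digit v = 1"
      using digit_cases[of u] digit_cases[of v] Suc.prems le by auto
    then show ?thesis
      using digit_2_less_digit_1 approx_bounds(1)[of N] less_imp_le[OF approx_bounds(2)[of N]]
      by (simp add: less_imp_le)
  qed
qed simp

lemma approx_tendsto: "(\<lambda>N. approx N u) \<longlonglongrightarrow> point u"
  unfolding point_def
  using approx_bounds(2) less_imp_le
  by (intro LIMSEQ_incseq_SUP incseq_SucI approx_Suc bdd_aboveI[of _ 0]) blast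

lemma point_bounds_weak: "- lam \<le> point u" "point u \<le> 0"
  using LIMSEQ_le_const[OF approx_tendsto[of u]] LIMSEQ_le_const2[OF approx_tendsto[of u]]
    approx_bounds less_imp_le by blast+

lemma point_rec: "point u = (unrot lam ^^ digit u) (point (u + \<theta>) + lam + 1)"
proof -
  let ?z = "point (u + \<theta>) + lam + 1"
  have z: "1 \<le> ?z" using point_bounds_weak(1)[of "u + \<theta>"] by simp
  have tend: "(\<lambda>N. unrot lam (X N)) \<longlonglongrightarrow> unrot lam y" if "X \<longlonglongrightarrow> y" "0 < y + lam" for X y
    using that unfolding unrot_def by (intro tendsto_intros) auto
  have lim: "(\<lambda>N. approx N (u + \<theta>) + lam + 1) \<longlonglongrightarrow> ?z"
    by (intro tendsto_intros approx_tendsto)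
  have lim1: "(\<lambda>N. unrot lam (approx N (u + \<theta>) + lam + 1)) \<longlonglongrightarrow> unrot lam ?z"
    using z lam_ge_1 by (intro tend[OF lim]) auto
  have lim2: "(\<lambda>N. unrot lam (unrot lam (approx N (u + \<theta>) + lam + 1)))
      \<longlonglongrightarrow> unrot lam (unrot lam ?z)"
    using unrot_translate_gt[OF point_bounds_weak(1)[of "u + \<theta>"]] by (intro tend[OF lim1]) auto
  have "(\<lambda>N. approx (Suc N) u) \<longlonglongrightarrow> (unrot lam ^^ digit u) ?z"
    using digit_cases[of u] lim1 lim2 by (auto simp: numeral_2_eq_2)
  moreover have "(\<lambda>N. approx (Suc N) u) \<longlonglongrightarrow> point u"
    using approx_tendsto[of u] by (rule LIMSEQ_Suc)
  ultimately show ?thesis using LIMSEQ_unique by blast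
qed

lemma point_bounds: "- lam < point u" "point u < 0"
proof -
  have "0 < point (u + \<theta>) + lam + 1" using point_bounds_weak(1)[of "u + \<theta>"] by simp
  then show "- lam < point u" "point u < 0"
    using digit_bounds[of u] by (subst point_rec; auto intro!: unrot_pow_gt unrot_pow_neg)+
qed

lemma point_periodic: "point (u + of_int j) = point u"
  by (simp add: point_def approx_periodic)

lemma point_mono: "u \<le> v \<Longrightarrow> \<lfloor>u\<rfloor> = \<lfloor>v\<rfloor> \<Longrightarrow> point u \<le> point v"
  using approx_mono by (intro LIMSEQ_le[OF approx_tendsto approx_tendsto]) auto

lemma point_ge_start: "point 0 \<le> point u"
proof -
  have "point 0 \<le> point (frac u)"
    using frac_lt_1[of u] by (intro point_mono) (auto simp: floor_eq_iff)
  also have "point (frac u) = point u"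
    using point_periodic[of "frac u" "\<lfloor>u\<rfloor>"] by (simp add: frac_def)
  finally show ?thesis .
qed

text \<open>
  The two branches differ by one application of \<open>rot\<close>, so \<open>rot a\<close> is the upper branch at the point where
  \<open>a\<close> is the lower one.
\<close>

lemma rot_start: "rot lam (point 0) = unrot lam (point \<theta> + lam + 1)"
proof -
  have "digit 0 = 2" using theta by (simp add: digit_def floor_eq_iff)
  then have "point 0 = unrot lam (unrot lam (point \<theta> + lam + 1))"
    using point_rec[of 0] by (simp add: numeral_2_eq_2)
  moreover have "- lam < unrot lam (point \<theta> + lam + 1)"
    by (intro unrot_translate_gt point_bounds_weak)
  ultimately show ?thesis by (simp add: rot_unrot)
qed

end

text \<open>
  The coded point determines all digits, since the branches are injective with disjoint
  images.  The partial digit sums count the integers passed.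
\<close>

lemma sturmian_point_eqD:
  assumes S: "sturmian n lam \<theta>" "sturmian n lam \<theta>'"
    and eq: "sturmian.point lam \<theta> u = sturmian.point lam \<theta>' v"
  shows "\<lfloor>u + real i * \<theta>\<rfloor> - \<lfloor>u\<rfloor> = \<lfloor>v + real i * \<theta>'\<rfloor> - \<lfloor>v\<rfloor>"
proof -
  interpret S: sturmian n lam \<theta> by (rule S)
  interpret S': sturmian n lam \<theta>' by (rule S)
  have step: "S.digit u = S'.digit v \<and> S.point (u + \<theta>) = S'.point (v + \<theta>')"
    if "S.point u = S'.point v" for u v
  proof -
    let ?x = "S.point (u + \<theta>)" and ?y = "S'.point (v + \<theta>')"
    have b: "- lam \<le> ?x" "- lam \<le> ?y" "?x \<le> 0" "?y \<le> 0"
      using S.point_bounds_weak S'.point_bounds_weak by blast+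
    have e: "(unrot lam ^^ S.digit u) (?x + lam + 1) = (unrot lam ^^ S'.digit v) (?y + lam + 1)"
      using that by (simp only: S.point_rec[symmetric] S'.point_rec[symmetric])
    have d: "S.digit u = S'.digit v"
      using e S.digit_cases[of u] S'.digit_cases[of v]
        S.digit_2_less_digit_1[OF b(1,2,3)] S.digit_2_less_digit_1[OF b(2,1,4)] by auto
    have "?x + lam + 1 = ?y + lam + 1"
    proof (rule S.unrot_pow_inj)
      show "(unrot lam ^^ S'.digit v) (?x + lam + 1) = (unrot lam ^^ S'.digit v) (?y + lam + 1)"
        using e by (simp only: d)
      show "0 \<le> ?x + lam + 1" "0 \<le> ?y + lam + 1" using b by linarith+
      show "S'.digit v \<le> n - 2" by (rule S'.digit_bounds)
    qed
    with d show ?thesis by simp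
  qed
  have points: "S.point (u + real i * \<theta>) = S'.point (v + real i * \<theta>')" for i
  proof (induction i)
    case (Suc i)
    then show ?case using step[OF Suc] by (simp add: algebra_simps)
  qed (simp add: eq)
  show ?thesis
  proof (induction i)
    case (Suc i)
    have "S.digit (u + real i * \<theta>) = S'.digit (v + real i * \<theta>')"
      using step[OF points] by blast
    then have "\<lfloor>u + real i * \<theta> + \<theta>\<rfloor> - \<lfloor>u + real i * \<theta>\<rfloor> = \<lfloor>v + real i * \<theta>' + \<theta>'\<rfloor> - \<lfloor>v + real i * \<theta>'\<rfloor>"
      using S.digit_cases[of "u + real i * \<theta>"] S'.digit_cases[of "v + real i * \<theta>'"] by auto
    with Suc show ?case by (simp add: algebra_simps)
  qed simp
qed

lemma eq_if_linear_bounded: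
  fixes x y C :: real
  assumes "\<And>i::nat. \<bar>real i * x - real i * y\<bar> \<le> C"
  shows "x = y"
proof (rule ccontr)
  assume "x \<noteq> y"
  then obtain i :: nat where "C < real i * \<bar>x - y\<bar>"
    using reals_Archimedean3[of "\<bar>x - y\<bar>"] by auto
  also have "real i * \<bar>x - y\<bar> = \<bar>real i * x - real i * y\<bar>"
    by (simp add: abs_mult flip: right_diff_distrib)
  finally show False using assms[of i] by simp
qed

context sturmian begin

text \<open>
  A step of the upper branch carries the rotation into \<open>[0, \<theta>)\<close>, so that monotonicity compares the
  next point with the one at \<open>\<theta>\<close>.  Equality would make the digits eventually periodic and \<open>\<theta>\<close> rational.
\<close>

lemma point_less_rot_start:
  assumes "\<theta> \<notin> \<rat>"
  shows "point (real m * \<theta>) < rot lam (point 0)"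
proof -
  let ?u = "real m * \<theta>"
  have b: "- lam \<le> point v" "point v \<le> 0" for v using point_bounds_weak by blast+
  show ?thesis
  proof (cases "digit ?u = 2")
    case True
    then show ?thesis
      using digit_2_less_digit_1[OF b(1) b(1) b(2)] by (simp only: rot_start point_rec[of ?u])
  next
    case False
    then have d: "digit ?u = 1" "\<lfloor>?u + \<theta>\<rfloor> = \<lfloor>?u\<rfloor> + 1" using digit_cases[of ?u] by auto
    have "m \<noteq> 0"
    proof
      assume "m = 0"
      with d(2) theta show False by (simp add: floor_eq_iff)
    qed
    \<comment> \<open>The fractional part, at most \<open>\<theta>\<close> because an integer lies between \<open>?u\<close> and \<open>?u + \<theta>\<close>.\<close>
    define v where "v = ?u + \<theta> - of_int \<lfloor>?u + \<theta>\<rfloor>"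
    have v: "0 \<le> v" "v \<le> \<theta>" using d(2) unfolding v_def by linarith+
    have pv: "point v = point (?u + \<theta>)"
      using point_periodic[of v "\<lfloor>?u + \<theta>\<rfloor>"] by (simp add: v_def)
    have "\<lfloor>v\<rfloor> = 0" "\<lfloor>\<theta>\<rfloor> = 0" using v theta by (simp_all add: floor_eq_iff)
    then have "point v \<le> point \<theta>" using v(2) by (intro point_mono) auto
    moreover have "point (?u + \<theta>) \<noteq> point \<theta>"
    proof
      assume "point (?u + \<theta>) = point \<theta>"
      then have *: "\<lfloor>?u + \<theta> + real i * \<theta>\<rfloor> - \<lfloor>?u + \<theta>\<rfloor> = \<lfloor>\<theta> + real i * \<theta>\<rfloor> - \<lfloor>\<theta>\<rfloor>" for i
        using sturmian_point_eqD[OF sturmian_axioms sturmian_axioms] by blast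
      define c where "c = \<lfloor>?u + \<theta>\<rfloor> - \<lfloor>\<theta>\<rfloor>"
      \<comment> \<open>Going \<open>m\<close> steps further always passes \<open>c\<close> integers, so \<open>m \<theta> = c\<close>.\<close>
      have floor: "\<lfloor>\<theta> + real j * ?u\<rfloor> = int j * c + \<lfloor>\<theta>\<rfloor>" for j
      proof (induction j)
        case (Suc j)
        have "\<lfloor>\<theta> + real (Suc j) * ?u\<rfloor> = \<lfloor>?u + \<theta> + real (j * m) * \<theta>\<rfloor>"
          by (simp add: algebra_simps)
        also have "\<dots> = c + \<lfloor>\<theta> + real j * ?u\<rfloor>"
          using *[of "j * m"] by (simp add: c_def algebra_simps)
        finally show ?case using Suc by (simp add: algebra_simps)
      qed simp
      have "?u = of_int c"
      proof (rule eq_if_linear_bounded)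
        fix j :: nat
        have "\<lfloor>\<theta>\<rfloor> = 0" using theta by (simp add: floor_eq_iff)
        then have "of_int (\<lfloor>\<theta> + real j * ?u\<rfloor>) = real j * of_int c" using floor[of j] by simp
        then show "\<bar>real j * ?u - real j * of_int c\<bar> \<le> 1" using theta by linarith
      qed
      then have "\<theta> = of_int c / of_nat m" using \<open>m \<noteq> 0\<close> by (simp add: field_simps)
      then have "\<theta> \<in> \<rat>" by simp
      with assms show False ..
    qed
    ultimately have "point (?u + \<theta>) < point \<theta>" using pv by simp
    then have "unrot lam (point (?u + \<theta>) + lam + 1) < unrot lam (point \<theta> + lam + 1)"
      using b(1)[of "?u + \<theta>"] lam_ge_1 by (intro unrot_strict_mono) auto
    then show ?thesis using d(1) by (simp add: rot_start point_rec[of ?u])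
  qed
qed

lemma not_synchronizes_at_point:
  assumes "\<theta> \<notin> \<rat>" "alpha_param n lam \<alpha> (point 0)"
  shows "\<not> synchronizes n \<alpha>"
proof -
  interpret alpha_param n lam \<alpha> "point 0" by fact
  show ?thesis
  proof (rule not_synchronizes_if_sequence[where x = "\<lambda>m. point (real m * \<theta>)"
        and k = "\<lambda>m. digit (real m * \<theta>)"])
    show "point (real m * \<theta>) = (unrot lam ^^ digit (real m * \<theta>)) (point (real (Suc m) * \<theta>) + lam + 1)" for m
      using point_rec[of "real m * \<theta>"] by (simp only: of_nat_Suc distrib_right mult_1 add.commute)
    show "point (real m * \<theta>) < rot lam (point 0)" for m
      by (rule point_less_rot_start[OF assms(1)])
  qed (rule point_bounds digit_bounds point_ge_start | simp)+
qed

end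

section \<open>The end points of the parameter range\<close>

context hecke_param begin

text \<open>
  The defining equation is \<open>\<rho> (1 + t - \<rho>) = 1\<close> for the right end point \<open>\<rho>\<close>.  Its roots are inverse to each
  other with sum \<open>1 + t\<close>, so only the one less than one is below \<open>t\<close>.
\<close>

lemma gamma3_root:
  obtains \<rho> where "gamma3 n * (lam + 1) = \<rho>" "0 < \<rho>" "\<rho> < 1" "\<rho> * (2 + lam - \<rho>) = 1"
proof -
  define w where "w = sqrt ((2 + lam)\<^sup>2 - 4)"
  define \<rho> where "\<rho> = (2 + lam - w) / 2"
  have "(2 + lam)\<^sup>2 - 4 \<ge> 0" using lam_ge_1 by (simp add: power2_eq_square algebra_simps)
  then have w: "w\<^sup>2 = (2 + lam)\<^sup>2 - 4" by (simp add: w_def)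
  have "w < 2 + lam" unfolding w_def using lam_ge_1 by (intro real_less_lsqrt) auto
  moreover have "lam < w"
    unfolding w_def using lam_ge_1 by (intro real_less_rsqrt) (simp add: power2_eq_square algebra_simps)
  ultimately have \<rho>: "0 < \<rho>" "\<rho> < 1" by (simp_all add: \<rho>_def)
  have root: "\<rho> * (2 + lam - \<rho>) = 1"
  proof -
    have "\<rho> * (2 + lam - \<rho>) = ((2 + lam)\<^sup>2 - w\<^sup>2) / 4"
      by (simp add: \<rho>_def power2_eq_square field_simps)
    then show ?thesis by (simp add: w)
  qed
  have inv: "matrix_inv matC = mat2 0 (- 1) 1 (- 1)"
    by (simp add: matC_def matrix_inv_mat2_det_1)
  have char: "moeb (matrix_inv matC) (ell0 n \<beta>) = Some (r0 n \<beta>) \<longleftrightarrow>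
      \<beta> * (lam + 1) * (2 + lam - \<beta> * (lam + 1)) = 1" if "0 < \<beta>" "\<beta> < 1" for \<beta>
  proof -
    have "ell0 n \<beta> < 1"
      using that lam_ge_1 mult_neg_pos[of "\<beta> - 1" "lam + 1"] by (simp add: ell0_def tpar_eq)
    then have "moeb (matrix_inv matC) (ell0 n \<beta>) = Some (1 / (1 - ell0 n \<beta>))"
      using moeb_C2[of "ell0 n \<beta>"] by (simp add: inv mat_pow_matC)
    moreover have "1 - ell0 n \<beta> = 2 + lam - \<beta> * (lam + 1)"
      by (simp add: ell0_def tpar_eq algebra_simps)
    ultimately show ?thesis
      using \<open>ell0 n \<beta> < 1\<close> by (auto simp add: r0_def tpar_eq field_simps)
  qed
  have "gamma3 n = \<rho> / (lam + 1)"
    unfolding gamma3_def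
  proof (rule the_equality)
    have "0 < \<rho> / (lam + 1)" "\<rho> / (lam + 1) < 1" "\<rho> / (lam + 1) * (lam + 1) = \<rho>"
      using \<rho> lam_ge_1 by (simp_all add: field_simps)
    then show "0 < \<rho> / (lam + 1) \<and> \<rho> / (lam + 1) < 1 \<and>
        moeb (matrix_inv matC) (ell0 n (\<rho> / (lam + 1))) = Some (r0 n (\<rho> / (lam + 1)))"
      using root by (simp add: char)
  next
    fix \<beta> assume \<beta>: "0 < \<beta> \<and> \<beta> < 1 \<and> moeb (matrix_inv matC) (ell0 n \<beta>) = Some (r0 n \<beta>)"
    define \<sigma> where "\<sigma> = \<beta> * (lam + 1)"
    have \<sigma>: "\<sigma> * (2 + lam - \<sigma>) = 1" using \<beta> char[of \<beta>] by (simp add: \<sigma>_def)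
    have "\<sigma> < lam + 1" using \<beta> lam_ge_1 by (simp add: \<sigma>_def)
    have "(\<sigma> - \<rho>) * (2 + lam - \<sigma> - \<rho>) = 0" using \<sigma> root by (simp add: algebra_simps)
    then have "\<sigma> = \<rho>" using \<open>\<sigma> < lam + 1\<close> \<rho> by auto
    then show "\<beta> = \<rho> / (lam + 1)" using lam_ge_1 by (simp add: \<sigma>_def field_simps)
  qed
  then have "gamma3 n * (lam + 1) = \<rho>" using lam_ge_1 by simp
  then show thesis using \<rho> root by (rule that)
qed

text \<open>
  The defining equation is quadratic in the left end point \<open>e\<close>, with roots of product one and sum
  \<open>1 - 2 t\<close>; only one of them is greater than \<open>-t\<close>.
\<close>

lemma epsilon3_root:
  obtains e where "epsilon3 n = e / (lam + 1) + 1" "- lam < e" "e < 0" "e\<^sup>2 + (2 * lam + 1) * e + 1 = 0"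
proof -
  define w where "w = sqrt ((2 * lam + 1)\<^sup>2 - 4)"
  define e where "e = (w - (2 * lam + 1)) / 2"
  have sq: "3 * 3 \<le> (2 * lam + 1) * (2 * lam + 1)"
    using lam_ge_1 by (intro mult_mono) auto
  then have "(2 * lam + 1)\<^sup>2 - 4 \<ge> 0" by (simp only: power2_eq_square)
  then have w: "w\<^sup>2 = (2 * lam + 1)\<^sup>2 - 4" by (simp add: w_def)
  have "w < 2 * lam + 1" unfolding w_def using lam_ge_1 by (intro real_less_lsqrt) auto
  moreover have "1 < w"
    unfolding w_def power2_eq_square using sq by (intro real_less_rsqrt) simp
  ultimately have e: "- lam < e" "e < 0" by (simp_all add: e_def)
  have root: "e\<^sup>2 + (2 * lam + 1) * e + 1 = 0"
  proof -
    have "e\<^sup>2 + (2 * lam + 1) * e + 1 = (w\<^sup>2 - (2 * lam + 1)\<^sup>2) / 4 + 1"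
      by (simp add: e_def power2_eq_square field_simps)
    then show ?thesis by (simp add: w)
  qed
  have char: "moeb (matrix_inv (matA n) ** matC) (ell0 n \<beta>) = Some (r0 n \<beta>) \<longleftrightarrow>
      (ell0 n \<beta>)\<^sup>2 + (2 * lam + 1) * ell0 n \<beta> + 1 = 0" if "0 < \<beta>" "\<beta> < 1" for \<beta>
  proof -
    let ?a = "ell0 n \<beta>"
    have neg: "?a < 0"
      using that lam_ge_1 by (simp add: ell0_def tpar_eq mult_neg_pos)
    have C: "moeb matC ?a = Some (1 - 1 / ?a)"
      using moeb_C[of ?a, unfolded mat_pow_matC, folded matC_def] neg by simp
    have "moeb (matrix_inv (matA n) ** matC) ?a = Some (- lam - 1 / ?a)"
      by (simp add: matA_def matrix_inv_mat2_det_1 moeb_shear_mult C tpar_eq)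
    moreover have "r0 n \<beta> = ?a + lam + 1"
      by (simp add: r0_def ell0_def tpar_eq algebra_simps)
    ultimately show ?thesis
      using neg by (simp add: field_simps power2_eq_square)
  qed
  define \<epsilon> where "\<epsilon> = e / (lam + 1) + 1"
  have "epsilon3 n = \<epsilon>"
    unfolding epsilon3_def
  proof (rule the_equality)
    have "0 < \<epsilon>" "\<epsilon> < 1" "ell0 n \<epsilon> = e"
      using e lam_ge_1 by (simp_all add: \<epsilon>_def ell0_def tpar_eq field_simps)
    then show "0 < \<epsilon> \<and> \<epsilon> < 1 \<and> moeb (matrix_inv (matA n) ** matC) (ell0 n \<epsilon>) = Some (r0 n \<epsilon>)"
      using root char[of \<epsilon>] by simp
  next
    fix \<beta> assume \<beta>: "0 < \<beta> \<and> \<beta> < 1 \<and>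
      moeb (matrix_inv (matA n) ** matC) (ell0 n \<beta>) = Some (r0 n \<beta>)"
    define a where "a = ell0 n \<beta>"
    have a: "a\<^sup>2 + (2 * lam + 1) * a + 1 = 0" using \<beta> char[of \<beta>] by (simp add: a_def)
    have "a + (lam + 1) = \<beta> * (lam + 1)" by (simp add: a_def ell0_def tpar_eq algebra_simps)
    then have "- lam - 1 < a" using \<beta> lam_ge_1 by (smt (verit) mult_pos_pos)
    have "(a - e) * (a + e + (2 * lam + 1)) = 0"
      using a root by (simp add: power2_eq_square algebra_simps)
    then have "a = e" using \<open>- lam - 1 < a\<close> e by auto
    then show "\<beta> = \<epsilon>"
      using lam_ge_1 by (simp add: \<epsilon>_def a_def ell0_def tpar_eq field_simps)
  qed
  then show thesis using e root by (intro that) (simp_all add: \<epsilon>_def)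
qed

lemma gamma3_pos: "0 < gamma3 n" and gamma3_lam_less_1: "gamma3 n * (lam + 1) < 1"
proof -
  obtain \<rho> where "gamma3 n * (lam + 1) = \<rho>" "0 < \<rho>" "\<rho> < 1" by (rule gamma3_root)
  then show "gamma3 n * (lam + 1) < 1" "0 < gamma3 n"
    using lam_ge_1 by (auto simp: zero_less_mult_iff)
qed

lemma epsilon3_less_1: "epsilon3 n < 1"
  by (rule epsilon3_root) (use lam_ge_1 in \<open>simp add: divide_less_0_iff\<close>)

end

context alpha_param begin

lemma start_in_terms_of_r: "a + lam + 1 = \<alpha> * (lam + 1)"
  by (simp add: a_eq ell0_def tpar_eq algebra_simps)

lemma gamma3_lessD:
  assumes "gamma3 n < \<alpha>" "a < - lam"
  shows "1 < (a + lam + 1) * (1 - a)"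
proof -
  obtain \<rho> where \<rho>: "gamma3 n * (lam + 1) = \<rho>" "0 < \<rho>" "\<rho> < 1" "\<rho> * (2 + lam - \<rho>) = 1"
    by (rule gamma3_root)
  define r where "r = a + lam + 1"
  have "\<rho> < r" unfolding r_def start_in_terms_of_r \<rho>(1)[symmetric] using assms lam_ge_1 by simp
  moreover have "r < 1" using assms by (simp add: r_def)
  ultimately have "0 < (r - \<rho>) * (2 + lam - r - \<rho>)"
    using \<rho> lam_ge_1 by (intro mult_pos_pos) auto
  also have "\<dots> = r * (2 + lam - r) - \<rho> * (2 + lam - \<rho>)" by (simp add: algebra_simps)
  finally show ?thesis using \<rho>(4) by (simp add: r_def)
qed

lemma less_epsilon3_iff: "\<alpha> < epsilon3 n \<longleftrightarrow> rot lam a < a + lam + 1"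
proof -
  obtain e where e: "epsilon3 n = e / (lam + 1) + 1" "- lam < e" "e < 0"
    "e\<^sup>2 + (2 * lam + 1) * e + 1 = 0" by (rule epsilon3_root)
  have "\<alpha> = a / (lam + 1) + 1"
    using lam_ge_1 by (simp add: a_eq ell0_def tpar_eq)
  then have "\<alpha> < epsilon3 n \<longleftrightarrow> a < e"
    using lam_ge_1 by (simp add: e(1) divide_less_cancel)
  also have "a < e \<longleftrightarrow> (a - e) * (a + e + (2 * lam + 1)) < 0"
    using r_pos e(2) by (auto simp: mult_less_0_iff)
  also have "(a - e) * (a + e + (2 * lam + 1)) = a * (a + lam + 1 - rot lam a)"
    using e(4) a_neg by (simp add: rot_def power2_eq_square algebra_simps)
  also have "\<dots> < 0 \<longleftrightarrow> rot lam a < a + lam + 1"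
    using a_neg by (auto simp: mult_less_0_iff)
  finally show ?thesis .
qed

lemma not_synchronizes_survives:
  assumes "gamma3 n < \<alpha>" "\<alpha> < epsilon3 n" "\<not> synchronizes n \<alpha>"
  shows "a \<in> survivors N"
proof (rule start_in_survivors)
  show "- lam < a" using synchronizes_if_r_le_1 gamma3_lessD assms by force
qed (use assms less_epsilon3_iff in auto)

text \<open>
  For \<open>n = 3\<close> the step has a single branch, \<open>a \<mapsto> rot a - t\<close>, and it moves \<open>a\<close> to the left by the
  choice of \<open>\<epsilon>\<close>.
\<close>

lemma synchronizes_3:
  assumes "n = 3" "gamma3 n < \<alpha>" "\<alpha> < epsilon3 n"
  shows "synchronizes n \<alpha>"
proof (rule ccontr)
  assume ns: "\<not> synchronizes n \<alpha>"
  have eps: "rot lam a < a + lam + 1" using assms(3) less_epsilon3_iff by blast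
  have a: "- lam < a" using synchronizes_if_r_le_1 gamma3_lessD assms(2) ns by force
  have "linked a" using hits_l_start a_neg r_pos by (simp add: linked_def Ialpha_eq)
  obtain k z where k: "1 \<le> k" "k \<le> n - 2" "0 \<le> z" "a = (unrot lam ^^ k) z"
    using unrot_pow_covers[of a] a a_neg by auto
  then have "k = 1" using assms(1) by simp
  then have "a = unrot lam z" using k by simp
  then have "z = rot lam a" using k(3) lam_ge_1 by (simp add: rot_unrot)
  have "linked (z - (lam + 1))"
    using linked_step[OF a eps \<open>linked a\<close> ns k(4,2,3)] by blast
  then have "a \<le> z - (lam + 1)" by (simp add: linked_def Ialpha_eq)
  with eps \<open>z = rot lam a\<close> show False by simp
qed

end

section \<open>The synchronization theorem\<close>

context hecke_param begin

lemma negligible_not_synchronizing: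
  "negligible {\<alpha>\<in>{gamma3 n<..<epsilon3 n}. \<not> synchronizes n \<alpha>}"
proof -
  let ?f = "\<lambda>a. a / (lam + 1) + 1"
  have "negligible (?f ` (\<Inter>N. survivors N))"
    unfolding divide_inverse
    by (intro negligible_differentiable_image_negligible negligible_survivors derivative_intros)
      auto
  moreover have "{\<alpha>\<in>{gamma3 n<..<epsilon3 n}. \<not> synchronizes n \<alpha>} \<subseteq> ?f ` (\<Inter>N. survivors N)"
  proof
    fix \<alpha> assume \<alpha>: "\<alpha> \<in> {\<alpha>\<in>{gamma3 n<..<epsilon3 n}. \<not> synchronizes n \<alpha>}"
    then interpret alpha_param n lam \<alpha> "ell0 n \<alpha>"
      using gamma3_pos epsilon3_less_1 by unfold_locales auto
    have "ell0 n \<alpha> \<in> (\<Inter>N. survivors N)" using not_synchronizes_survives \<alpha> by auto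
    moreover have "\<alpha> = ?f (ell0 n \<alpha>)" using lam_ge_1 by (simp add: ell0_def tpar_eq)
    ultimately show "\<alpha> \<in> ?f ` (\<Inter>N. survivors N)" by blast
  qed
  ultimately show ?thesis by (rule negligible_subset)
qed

text \<open>
  The coded point of \<open>0\<close> determines \<open>\<theta>\<close>: the number of integers passed in \<open>i\<close> steps is
  \<open>i \<theta>\<close> up to a bounded error.
\<close>

lemma uncountable_not_synchronizing:
  assumes "n > 3"
  shows "uncountable {\<alpha>\<in>{gamma3 n<..<epsilon3 n}. \<not> synchronizes n \<alpha>}"
proof -
  define P where "P \<theta> = sturmian.point lam \<theta> 0" for \<theta>
  define f where "f \<theta> = P \<theta> / (lam + 1) + 1" for \<theta>
  have S: "sturmian n lam \<theta>" if "\<theta> \<in> {0<..<1}" for \<theta>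
    using assms that by unfold_locales auto
  have "inj_on f ({0<..<1} - \<rat>)"
  proof (rule inj_onI)
    fix \<theta> \<theta>' assume \<theta>: "\<theta> \<in> {0<..<1} - \<rat>" "\<theta>' \<in> {0<..<1} - \<rat>" and "f \<theta> = f \<theta>'"
    then have "sturmian.point lam \<theta> 0 = sturmian.point lam \<theta>' 0"
      using lam_ge_1 by (simp add: f_def P_def)
    then have floor: "\<lfloor>0 + real i * \<theta>\<rfloor> - \<lfloor>0 :: real\<rfloor> = \<lfloor>0 + real i * \<theta>'\<rfloor> - \<lfloor>0 :: real\<rfloor>" for i
      using \<theta> by (intro sturmian_point_eqD[OF S S]) auto
    show "\<theta> = \<theta>'"
    proof (rule eq_if_linear_bounded)
      show "\<bar>real i * \<theta> - real i * \<theta>'\<bar> \<le> 1" for i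
        using floor[of i] by simp linarith
    qed
  qed
  moreover have "uncountable ({0<..<1 :: real} - \<rat>)"
    by (intro uncountable_minus_countable countable_rat) (simp add: uncountable_open_interval)
  ultimately have "uncountable (f ` ({0<..<1} - \<rat>))"
    using countable_image_inj_on by blast
  moreover have "f ` ({0<..<1} - \<rat>) \<subseteq> {\<alpha>\<in>{gamma3 n<..<epsilon3 n}. \<not> synchronizes n \<alpha>}"
  proof clarify
    fix \<theta> :: real assume \<theta>: "\<theta> \<in> {0<..<1}" "\<theta> \<notin> \<rat>"
    interpret sturmian n lam \<theta> by (rule S[OF \<theta>(1)])
    have b: "- lam < P \<theta>" "P \<theta> < 0" using point_bounds by (simp_all add: P_def)
    have P: "P \<theta> = ell0 n (f \<theta>)" using lam_ge_1 by (simp add: f_def ell0_def tpar_eq)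
    interpret alpha_param n lam "f \<theta>" "P \<theta>"
    proof
      show "P \<theta> = ell0 n (f \<theta>)" by (rule P)
      show "0 < f \<theta>" "f \<theta> < 1" using b lam_ge_1 by (simp_all add: f_def field_simps)
    qed
    have "1 < f \<theta> * (lam + 1)" using b start_in_terms_of_r by simp
    then have "gamma3 n * (lam + 1) < f \<theta> * (lam + 1)" using gamma3_lam_less_1 by simp
    then have "gamma3 n < f \<theta>" using lam_ge_1 by simp
    moreover have "rot lam (P \<theta>) < 0"
      unfolding P_def rot_start using point_bounds[of \<theta>] lam_ge_1 by (intro unrot_neg) auto
    then have "f \<theta> < epsilon3 n" using less_epsilon3_iff r_pos by simp
    moreover have "\<not> synchronizes n (f \<theta>)"
      using not_synchronizes_at_point[of "f \<theta>"] \<theta>(2) alpha_param_axioms by (simp add: P_def)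
    ultimately show "f \<theta> \<in> {gamma3 n<..<epsilon3 n} \<and> \<not> synchronizes n (f \<theta>)" by simp
  qed
  ultimately show ?thesis using countable_subset by blast
qed

end

theorem theorem67:
  fixes n :: nat
  assumes "n \<ge> 3"
  shows "(n = 3 \<longrightarrow> (\<forall>\<alpha>\<in>{gamma3 3<..<epsilon3 3}. synchronizes 3 \<alpha>)) \<and>
    (n > 3 \<longrightarrow>
      uncountable {\<alpha>\<in>{gamma3 n<..<epsilon3 n}. \<not> synchronizes n \<alpha>} \<and>
      {\<alpha>\<in>{gamma3 n<..<epsilon3 n}. \<not> synchronizes n \<alpha>} \<in> null_sets lebesgue)"
proof -
  interpret hecke_param n "2 * cos (pi / real n)"
    using assms by unfold_locales auto
  have "synchronizes n \<alpha>" if "n = 3" "\<alpha> \<in> {gamma3 n<..<epsilon3 n}" for \<alpha>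
  proof -
    interpret alpha_param n "2 * cos (pi / real n)" \<alpha> "ell0 n \<alpha>"
      using that gamma3_pos epsilon3_less_1 by unfold_locales auto
    show ?thesis using that by (intro synchronizes_3) auto
  qed
  then show ?thesis
    using uncountable_not_synchronizing negligible_not_synchronizing
    by (auto simp: negligible_iff_null_sets)
qed

end
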